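(* Let $A$ be an $R$-algebra over a commutative ring $R$ with $1_R\neq 0_R$, and let $\mathcal{C}$ be a non-zero $A$-coring with counit $\varepsilon_{\mathcal{C}}$ such that ${}_A\mathcal{C}$ and $\mathcal{C}_A$ are flat. Then the map $$\phi_{\mathcal{C}}:\mathbf{C}(\mathcal{C})\to{}^{\mathcal{C}}\mathrm{End}^{\mathcal{C}}(\mathcal{C}),\qquad f\mapsto[c\mapsto f\rightharpoonup c=c\leftharpoonup f],$$ is an isomorphism of $R$-algebras, with inverse $\psi_{\mathcal{C}}:g\mapsto\varepsilon_{\mathcal{C}}\circ g$. In particular, $({}^{\mathcal{C}}\mathrm{End}^{\mathcal{C}}(\mathcal{C}),\circ)$ is commutative and $\mathcal{C}$ is duo as a $(\mathcal{C},\mathcal{C})$-bicomodule.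
   Context: Here $\mathcal{C}$ is regarded as a $(\mathcal{C},\mathcal{C})$-bicomodule via its comultiplication $c\mapsto\sum c_1\otimes_A c_2$, and ${}^{\mathcal{C}}\mathrm{End}^{\mathcal{C}}(\mathcal{C})$ is the ring of its $(\mathcal{C},\mathcal{C})$-bicolinear endomorphisms. ${}^*\mathcal{C}^*:=\mathrm{Hom}_{(A,A)}(\mathcal{C},A)$ (the $(A,A)$-bilinear maps) with multiplication $(f*g)(c)=\sum f(c_1)g(c_2)$ and unit $\varepsilon_{\mathcal{C}}$. For $f\in{}^*\mathcal{C}^*$ and $c\in\mathcal{C}$: $f\rightharpoonup c:=\sum c_1f(c_2)$ and $c\leftharpoonup f:=\sum f(c_1)c_2$. The centralizer is the $R$-algebra $\mathbf{C}(\mathcal{C}):=\{f\in{}^*\mathcal{C}^*\mid f\rightharpoonup c=c\leftharpoonup f\text{ for every }c\in\mathcal{C}\}$. A $(\mathcal{C},\mathcal{C})$-bicomodule $M$ is duo iff every $(\mathcal{C},\mathcal{C})$-subbicomodule $L\subseteq M$ is fully invariant, i.e. $f(L)\subseteq L$ for every $(\mathcal{C},\mathcal{C})$-bicolinear endomorphism $f$ of $M$. *)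

theory Defs
  imports "HOL-Algebra.Free_Abelian_Groups" "HOL-Algebra.Module" "HOL-Algebra.QuotRing"
begin

section \<open>Algebras, modules and bimodules\<close>

text \<open>The library locale \<open>algebra\<close> is confined to commutative \<open>A\<close>; here \<open>A\<close> is an arbitrary
  unital associative algebra over the commutative ring \<open>R\<close>.\<close>

locale assoc_algebra = module R A + ring A for R (structure) and A (structure) +
  assumes smult_mult_left:
      "\<lbrakk>r \<in> carrier R; a \<in> carrier A; b \<in> carrier A\<rbrakk> \<Longrightarrow>
        (r \<odot>\<^bsub>A\<^esub> a) \<otimes>\<^bsub>A\<^esub> b = r \<odot>\<^bsub>A\<^esub> (a \<otimes>\<^bsub>A\<^esub> b)"
    and smult_mult_right:
      "\<lbrakk>r \<in> carrier R; a \<in> carrier A; b \<in> carrier A\<rbrakk> \<Longrightarrow>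
        a \<otimes>\<^bsub>A\<^esub> (r \<odot>\<^bsub>A\<^esub> b) = r \<odot>\<^bsub>A\<^esub> (a \<otimes>\<^bsub>A\<^esub> b)"

definition algebra_iso ::
    "('r, 'p) ring_scheme \<Rightarrow> ('r, 'x, 'q) module_scheme \<Rightarrow> ('r, 'y, 's) module_scheme \<Rightarrow> ('x \<Rightarrow> 'y) set"
  where "algebra_iso R X Y =
    {h \<in> ring_iso X Y. \<forall>r \<in> carrier R. \<forall>x \<in> carrier X. h (r \<odot>\<^bsub>X\<^esub> x) = r \<odot>\<^bsub>Y\<^esub> h x}"

text \<open>As for the library's \<open>module\<close> record, the multiplicative fields inherited from \<open>ring\<close> carry no
  meaning. One-sided modules use the same record, with the other action left unconstrained.\<close>

record ('a, 'm) bimod = "'m ring" +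
  lact :: "'a \<Rightarrow> 'm \<Rightarrow> 'm"
  ract :: "'m \<Rightarrow> 'a \<Rightarrow> 'm"

locale left_module = A: ring A + M: abelian_group M for A and M (structure) +
  assumes lact_closed: "\<lbrakk>a \<in> carrier A; x \<in> carrier M\<rbrakk> \<Longrightarrow> lact M a x \<in> carrier M"
    and lact_add_scalar: "\<lbrakk>a \<in> carrier A; b \<in> carrier A; x \<in> carrier M\<rbrakk> \<Longrightarrow>
          lact M (a \<oplus>\<^bsub>A\<^esub> b) x = lact M a x \<oplus>\<^bsub>M\<^esub> lact M b x"
    and lact_add: "\<lbrakk>a \<in> carrier A; x \<in> carrier M; y \<in> carrier M\<rbrakk> \<Longrightarrow>
          lact M a (x \<oplus>\<^bsub>M\<^esub> y) = lact M a x \<oplus>\<^bsub>M\<^esub> lact M a y"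
    and lact_mult: "\<lbrakk>a \<in> carrier A; b \<in> carrier A; x \<in> carrier M\<rbrakk> \<Longrightarrow>
          lact M (a \<otimes>\<^bsub>A\<^esub> b) x = lact M a (lact M b x)"
    and lact_one: "x \<in> carrier M \<Longrightarrow> lact M \<one>\<^bsub>A\<^esub> x = x"

locale right_module = A: ring A + M: abelian_group M for A and M (structure) +
  assumes ract_closed: "\<lbrakk>a \<in> carrier A; x \<in> carrier M\<rbrakk> \<Longrightarrow> ract M x a \<in> carrier M"
    and ract_add_scalar: "\<lbrakk>a \<in> carrier A; b \<in> carrier A; x \<in> carrier M\<rbrakk> \<Longrightarrow>
          ract M x (a \<oplus>\<^bsub>A\<^esub> b) = ract M x a \<oplus>\<^bsub>M\<^esub> ract M x b"
    and ract_add: "\<lbrakk>a \<in> carrier A; x \<in> carrier M; y \<in> carrier M\<rbrakk> \<Longrightarrow>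
          ract M (x \<oplus>\<^bsub>M\<^esub> y) a = ract M x a \<oplus>\<^bsub>M\<^esub> ract M y a"
    and ract_mult: "\<lbrakk>a \<in> carrier A; b \<in> carrier A; x \<in> carrier M\<rbrakk> \<Longrightarrow>
          ract M x (a \<otimes>\<^bsub>A\<^esub> b) = ract M (ract M x a) b"
    and ract_one: "x \<in> carrier M \<Longrightarrow> ract M x \<one>\<^bsub>A\<^esub> = x"

text \<open>The last assumption is the usual convention for bimodules over an \<open>R\<close>-algebra: the two
  \<open>R\<close>-module structures induced by the left and the right action of \<open>A\<close> coincide.\<close>

locale bimodule = assoc_algebra R A + left_module A M + right_module A M
  for R (structure) and A (structure) and M (structure) +
  assumes lact_ract: "\<lbrakk>a \<in> carrier A; b \<in> carrier A; x \<in> carrier M\<rbrakk> \<Longrightarrow>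
        ract M (lact M a x) b = lact M a (ract M x b)"
    and central: "\<lbrakk>r \<in> carrier R; x \<in> carrier M\<rbrakk> \<Longrightarrow>
        lact M (r \<odot>\<^bsub>A\<^esub> \<one>\<^bsub>A\<^esub>) x = ract M x (r \<odot>\<^bsub>A\<^esub> \<one>\<^bsub>A\<^esub>)"

definition regular_bimod :: "('a, 'q) ring_scheme \<Rightarrow> ('a, 'a) bimod"
  where "regular_bimod A =
    \<lparr>carrier = carrier A, mult = mult A, one = \<one>\<^bsub>A\<^esub>, zero = \<zero>\<^bsub>A\<^esub>, add = add A,
     lact = mult A, ract = mult A\<rparr>"

definition left_hom ::
    "('a, 'q) ring_scheme \<Rightarrow> ('a, 'm, 'x) bimod_scheme \<Rightarrow> ('a, 'n, 'y) bimod_scheme \<Rightarrow> ('m \<Rightarrow> 'n) set"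
  where "left_hom A M N =
    {f \<in> carrier M \<rightarrow> carrier N.
       (\<forall>x \<in> carrier M. \<forall>y \<in> carrier M. f (x \<oplus>\<^bsub>M\<^esub> y) = f x \<oplus>\<^bsub>N\<^esub> f y) \<and>
       (\<forall>a \<in> carrier A. \<forall>x \<in> carrier M. f (lact M a x) = lact N a (f x))}"

definition right_hom ::
    "('a, 'q) ring_scheme \<Rightarrow> ('a, 'm, 'x) bimod_scheme \<Rightarrow> ('a, 'n, 'y) bimod_scheme \<Rightarrow> ('m \<Rightarrow> 'n) set"
  where "right_hom A M N =
    {f \<in> carrier M \<rightarrow> carrier N.
       (\<forall>x \<in> carrier M. \<forall>y \<in> carrier M. f (x \<oplus>\<^bsub>M\<^esub> y) = f x \<oplus>\<^bsub>N\<^esub> f y) \<and>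
       (\<forall>a \<in> carrier A. \<forall>x \<in> carrier M. f (ract M x a) = ract N (f x) a)}"

definition bimod_hom ::
    "('a, 'q) ring_scheme \<Rightarrow> ('a, 'm, 'x) bimod_scheme \<Rightarrow> ('a, 'n, 'y) bimod_scheme \<Rightarrow> ('m \<Rightarrow> 'n) set"
  where "bimod_hom A M N = left_hom A M N \<inter> right_hom A M N"


section \<open>Tensor products\<close>

text \<open>\<open>M \<otimes>\<^sub>A N\<close> is the free abelian group on \<open>carrier M \<times> carrier N\<close> modulo the subgroup below;
  its elements are cosets.\<close>

type_synonym ('m, 'n) tensor = "('m \<times> 'n \<Rightarrow>\<^sub>0 int) set"

definition tensor_free ::
    "('a, 'm, 'x) bimod_scheme \<Rightarrow> ('a, 'n, 'y) bimod_scheme \<Rightarrow> ('m \<times> 'n \<Rightarrow>\<^sub>0 int) monoid"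
  where "tensor_free M N = free_Abelian_group (carrier M \<times> carrier N)"

definition tensor_rel ::
    "('a, 'q) ring_scheme \<Rightarrow> ('a, 'm, 'x) bimod_scheme \<Rightarrow> ('a, 'n, 'y) bimod_scheme \<Rightarrow> ('m, 'n) tensor"
  where "tensor_rel A M N = generate (tensor_free M N)
    ({frag_of (x \<oplus>\<^bsub>M\<^esub> x', y) - frag_of (x, y) - frag_of (x', y) | x x' y.
        x \<in> carrier M \<and> x' \<in> carrier M \<and> y \<in> carrier N} \<union>
     {frag_of (x, y \<oplus>\<^bsub>N\<^esub> y') - frag_of (x, y) - frag_of (x, y') | x y y'.
        x \<in> carrier M \<and> y \<in> carrier N \<and> y' \<in> carrier N} \<union>
     {frag_of (ract M x a, y) - frag_of (x, lact N a y) | x a y.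
        x \<in> carrier M \<and> a \<in> carrier A \<and> y \<in> carrier N})"

definition tens ::
    "('a, 'q) ring_scheme \<Rightarrow> ('a, 'm, 'x) bimod_scheme \<Rightarrow> ('a, 'n, 'y) bimod_scheme \<Rightarrow>
      'm \<Rightarrow> 'n \<Rightarrow> ('m, 'n) tensor"
  where "tens A M N x y = tensor_rel A M N #>\<^bsub>tensor_free M N\<^esub> frag_of (x, y)"

text \<open>\<open>tensor_sum P \<beta> T\<close> is \<open>\<Sum> \<beta> x\<^sub>i y\<^sub>i\<close> in the abelian group \<open>P\<close> for \<open>T = \<Sum> x\<^sub>i \<otimes> y\<^sub>i\<close>. It is the
  homomorphism induced by \<open>\<beta>\<close>, independent of the chosen representative whenever \<open>\<beta>\<close> is
  \<open>A\<close>-balanced, which is the case in all uses below.\<close>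

definition tensor_sum ::
    "('p, 'q) ring_scheme \<Rightarrow> ('m \<Rightarrow> 'n \<Rightarrow> 'p) \<Rightarrow> ('m, 'n) tensor \<Rightarrow> 'p"
  where "tensor_sum P \<beta> T =
    (let t = (SOME t. t \<in> T)
     in finsum P (\<lambda>k. [Poly_Mapping.lookup t k] \<cdot>\<^bsub>P\<^esub> \<beta> (fst k) (snd k)) (Poly_Mapping.keys t))"

definition tensor_group ::
    "('a, 'q) ring_scheme \<Rightarrow> ('a, 'm, 'x) bimod_scheme \<Rightarrow> ('a, 'n, 'y) bimod_scheme \<Rightarrow>
      ('m, 'n) tensor ring"
  where "tensor_group A M N =
    \<lparr>carrier = rcosets\<^bsub>tensor_free M N\<^esub> (tensor_rel A M N),
     mult = undefined, one = undefined,
     zero = tensor_rel A M N, add = set_mult (tensor_free M N)\<rparr>"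

definition tensor_bimod ::
    "('a, 'q) ring_scheme \<Rightarrow> ('a, 'm, 'x) bimod_scheme \<Rightarrow> ('a, 'n, 'y) bimod_scheme \<Rightarrow>
      ('a, ('m, 'n) tensor) bimod"
  where "tensor_bimod A M N = ring.extend (tensor_group A M N)
    (bimod.fields
      (\<lambda>a. tensor_sum (tensor_group A M N) (\<lambda>x y. tens A M N (lact M a x) y))
      (\<lambda>T a. tensor_sum (tensor_group A M N) (\<lambda>x y. tens A M N x (ract N y a)) T))"

text \<open>\<open>f \<otimes>\<^sub>A g\<close> with codomain \<open>M' \<otimes>\<^sub>A N'\<close>.\<close>

definition tensor_map ::
    "('a, 'q) ring_scheme \<Rightarrow> ('a, 'm1, 'x) bimod_scheme \<Rightarrow> ('a, 'n1, 'y) bimod_scheme \<Rightarrow>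
      ('m \<Rightarrow> 'm1) \<Rightarrow> ('n \<Rightarrow> 'n1) \<Rightarrow> ('m, 'n) tensor \<Rightarrow> ('m1, 'n1) tensor"
  where "tensor_map A M' N' f g =
    tensor_sum (tensor_group A M' N') (\<lambda>x y. tens A M' N' (f x) (g y))"

text \<open>The canonical isomorphism \<open>(M \<otimes>\<^sub>A N) \<otimes>\<^sub>A P \<rightarrow> M \<otimes>\<^sub>A (N \<otimes>\<^sub>A P)\<close>.\<close>

definition tensor_assoc ::
    "('a, 'q) ring_scheme \<Rightarrow> ('a, 'm, 'x) bimod_scheme \<Rightarrow> ('a, 'n, 'y) bimod_scheme \<Rightarrow>
      ('a, 'p, 'z) bimod_scheme \<Rightarrow> (('m, 'n) tensor, 'p) tensor \<Rightarrow> ('m, ('n, 'p) tensor) tensor"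
  where "tensor_assoc A M N P =
    (let G = tensor_group A M (tensor_bimod A N P)
     in tensor_sum G (\<lambda>t z. tensor_sum G (\<lambda>x y. tens A M (tensor_bimod A N P) x (tens A N P y z)) t))"

text \<open>Flatness: tensoring preserves injectivity of module homomorphisms. The test modules have their
  carriers inside the type of the elements of \<open>A\<close>. These include \<open>A\<close> and all its one-sided ideals, so
  by the ideal criterion nothing is lost compared with test modules of arbitrary size.\<close>

definition flat_left :: "('a, 'q) ring_scheme \<Rightarrow> ('a, 'm, 'x) bimod_scheme \<Rightarrow> bool"
  where "flat_left A M \<longleftrightarrow> left_module A M \<and>
    (\<forall>(N :: ('a, 'a) bimod) (N' :: ('a, 'a) bimod) f.
       right_module A N \<and> right_module A N' \<and> f \<in> right_hom A N N' \<and> inj_on f (carrier N) \<longrightarrow>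
       inj_on (tensor_map A N' M f id) (carrier (tensor_group A N M)))"

definition flat_right :: "('a, 'q) ring_scheme \<Rightarrow> ('a, 'm, 'x) bimod_scheme \<Rightarrow> bool"
  where "flat_right A M \<longleftrightarrow> right_module A M \<and>
    (\<forall>(N :: ('a, 'a) bimod) (N' :: ('a, 'a) bimod) f.
       left_module A N \<and> left_module A N' \<and> f \<in> left_hom A N N' \<and> inj_on f (carrier N) \<longrightarrow>
       inj_on (tensor_map A M N' id f) (carrier (tensor_group A M N)))"


section \<open>Corings and bicomodules\<close>

record ('a, 'c) coring = "('a, 'c) bimod" +
  comult :: "'c \<Rightarrow> ('c, 'c) tensor"
  counit :: "'c \<Rightarrow> 'a"

locale A_coring = bimodule R A C for R (structure) and A (structure) and C (structure) +
  assumes comult_hom: "comult C \<in> bimod_hom A C (tensor_bimod A C C)"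
    and counit_hom: "counit C \<in> bimod_hom A C (regular_bimod A)"
    and coassoc: "c \<in> carrier C \<Longrightarrow>
      tensor_assoc A C C C (tensor_map A (tensor_bimod A C C) C (comult C) id (comult C c)) =
      tensor_map A C (tensor_bimod A C C) id (comult C) (comult C c)"
    and counit_left: "c \<in> carrier C \<Longrightarrow>
      tensor_sum C (\<lambda>x y. lact C (counit C x) y) (comult C c) = c"
    and counit_right: "c \<in> carrier C \<Longrightarrow>
      tensor_sum C (\<lambda>x y. ract C x (counit C y)) (comult C c) = c"

record ('a, 'c, 'm) bicomod = "('a, 'm) bimod" +
  rcoact :: "'m \<Rightarrow> ('m, 'c) tensor"
  lcoact :: "'m \<Rightarrow> ('c, 'm) tensor"

locale bicomodule = A_coring R A C + M: bimodule R A M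
  for R (structure) and A (structure) and C (structure) and M (structure) +
  assumes rcoact_hom: "rcoact M \<in> bimod_hom A M (tensor_bimod A M C)"
    and lcoact_hom: "lcoact M \<in> bimod_hom A M (tensor_bimod A C M)"
    and rcoact_coassoc: "m \<in> carrier M \<Longrightarrow>
      tensor_assoc A M C C (tensor_map A (tensor_bimod A M C) C (rcoact M) id (rcoact M m)) =
      tensor_map A M (tensor_bimod A C C) id (comult C) (rcoact M m)"
    and rcoact_counit: "m \<in> carrier M \<Longrightarrow>
      tensor_sum M (\<lambda>x c. ract M x (counit C c)) (rcoact M m) = m"
    and lcoact_coassoc: "m \<in> carrier M \<Longrightarrow>
      tensor_assoc A C C M (tensor_map A (tensor_bimod A C C) M (comult C) id (lcoact M m)) =
      tensor_map A C (tensor_bimod A C M) id (lcoact M) (lcoact M m)"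
    and lcoact_counit: "m \<in> carrier M \<Longrightarrow>
      tensor_sum M (\<lambda>c x. lact M (counit C c) x) (lcoact M m) = m"
    and coact_compat: "m \<in> carrier M \<Longrightarrow>
      tensor_assoc A C M C (tensor_map A (tensor_bimod A C M) C (lcoact M) id (rcoact M m)) =
      tensor_map A C (tensor_bimod A M C) id (rcoact M) (lcoact M m)"

definition bicolinear ::
    "('a, 'q) ring_scheme \<Rightarrow> ('a, 'c, 'v) coring_scheme \<Rightarrow> ('a, 'c, 'm, 'x) bicomod_scheme \<Rightarrow>
      ('a, 'c, 'n, 'y) bicomod_scheme \<Rightarrow> ('m \<Rightarrow> 'n) set"
  where "bicolinear A C M N =
    {f \<in> bimod_hom A M N.
       (\<forall>m \<in> carrier M. rcoact N (f m) = tensor_map A N C f id (rcoact M m)) \<and>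
       (\<forall>m \<in> carrier M. lcoact N (f m) = tensor_map A C N id f (lcoact M m))}"

definition self_bicomod :: "('a, 'c, 'v) coring_scheme \<Rightarrow> ('a, 'c, 'c) bicomod"
  where "self_bicomod C =
    \<lparr>carrier = carrier C, mult = mult C, one = \<one>\<^bsub>C\<^esub>, zero = \<zero>\<^bsub>C\<^esub>, add = add C,
     lact = lact C, ract = ract C, rcoact = comult C, lcoact = comult C\<rparr>"

definition subbicomodule ::
    "('r, 'p) ring_scheme \<Rightarrow> ('r, 'a, 'q) module_scheme \<Rightarrow> ('a, 'c, 'v) coring_scheme \<Rightarrow>
      ('a, 'c, 'm, 'x) bicomod_scheme \<Rightarrow> 'm set \<Rightarrow> bool"
  where "subbicomodule R A C M L \<longleftrightarrow> L \<subseteq> carrier M \<and>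
    (\<exists>\<rho> \<sigma>. let K = M\<lparr>carrier := L, rcoact := \<rho>, lcoact := \<sigma>\<rparr>
      in bicomodule R A C K \<and> (\<lambda>x. x) \<in> bicolinear A C K M)"

text \<open>Endomorphisms are represented by functions that are \<open>undefined\<close> off the carrier, so that
  equality of functions is equality of maps; likewise for \<open>bidual\<close> below.\<close>

definition bicomod_end ::
    "('r, 'a, 'q) module_scheme \<Rightarrow> ('a, 'c, 'v) coring_scheme \<Rightarrow>
      ('a, 'c, 'm, 'x) bicomod_scheme \<Rightarrow> ('r, 'm \<Rightarrow> 'm) module"
  where "bicomod_end A C M =
    \<lparr>carrier = bicolinear A C M M \<inter> extensional (carrier M),
     mult = (\<lambda>g h. compose (carrier M) g h),
     one = (\<lambda>m \<in> carrier M. m),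
     zero = (\<lambda>m \<in> carrier M. \<zero>\<^bsub>M\<^esub>),
     add = (\<lambda>g h. \<lambda>m \<in> carrier M. g m \<oplus>\<^bsub>M\<^esub> h m),
     smult = (\<lambda>r g. \<lambda>m \<in> carrier M. lact M (r \<odot>\<^bsub>A\<^esub> \<one>\<^bsub>A\<^esub>) (g m))\<rparr>"

definition duo ::
    "('r, 'p) ring_scheme \<Rightarrow> ('r, 'a, 'q) module_scheme \<Rightarrow> ('a, 'c, 'v) coring_scheme \<Rightarrow>
      ('a, 'c, 'm, 'x) bicomod_scheme \<Rightarrow> bool"
  where "duo R A C M \<longleftrightarrow>
    (\<forall>L. subbicomodule R A C M L \<longrightarrow> (\<forall>f \<in> bicolinear A C M M. f ` L \<subseteq> L))"


section \<open>The centralizer of a coring\<close>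

definition bidual ::
    "('r, 'a, 'q) module_scheme \<Rightarrow> ('a, 'c, 'v) coring_scheme \<Rightarrow> ('r, 'c \<Rightarrow> 'a) module"
  where "bidual A C =
    \<lparr>carrier = bimod_hom A C (regular_bimod A) \<inter> extensional (carrier C),
     mult = (\<lambda>f g. \<lambda>c \<in> carrier C. tensor_sum A (\<lambda>x y. f x \<otimes>\<^bsub>A\<^esub> g y) (comult C c)),
     one = restrict (counit C) (carrier C),
     zero = (\<lambda>c \<in> carrier C. \<zero>\<^bsub>A\<^esub>),
     add = (\<lambda>f g. \<lambda>c \<in> carrier C. f c \<oplus>\<^bsub>A\<^esub> g c),
     smult = (\<lambda>r f. \<lambda>c \<in> carrier C. r \<odot>\<^bsub>A\<^esub> f c)\<rparr>"

text \<open>\<open>f \<rightharpoonup> c = \<Sum> c\<^sub>1 f(c\<^sub>2)\<close> and \<open>c \<leftharpoonup> f = \<Sum> f(c\<^sub>1) c\<^sub>2\<close>.\<close>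

definition rharpoon :: "('a, 'c, 'v) coring_scheme \<Rightarrow> ('c \<Rightarrow> 'a) \<Rightarrow> 'c \<Rightarrow> 'c"
  where "rharpoon C f c = tensor_sum C (\<lambda>x y. ract C x (f y)) (comult C c)"

definition lharpoon :: "('a, 'c, 'v) coring_scheme \<Rightarrow> 'c \<Rightarrow> ('c \<Rightarrow> 'a) \<Rightarrow> 'c"
  where "lharpoon C c f = tensor_sum C (\<lambda>x y. lact C (f x) y) (comult C c)"

definition centralizer ::
    "('r, 'a, 'q) module_scheme \<Rightarrow> ('a, 'c, 'v) coring_scheme \<Rightarrow> ('r, 'c \<Rightarrow> 'a) module"
  where "centralizer A C = (bidual A C)
    \<lparr>carrier := {f \<in> carrier (bidual A C). \<forall>c \<in> carrier C. rharpoon C f c = lharpoon C c f}\<rparr>"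

definition phi :: "('a, 'c, 'v) coring_scheme \<Rightarrow> ('c \<Rightarrow> 'a) \<Rightarrow> 'c \<Rightarrow> 'c"
  where "phi C f = (\<lambda>c \<in> carrier C. rharpoon C f c)"

definition psi :: "('a, 'c, 'v) coring_scheme \<Rightarrow> ('c \<Rightarrow> 'c) \<Rightarrow> 'c \<Rightarrow> 'a"
  where "psi C g = compose (carrier C) (counit C) g"

end

theory Submission
  imports Defs
begin

text \<open>
  Write \<open>\<Delta>\<close> and \<open>\<epsilon>\<close> for comultiplication and counit, and \<open>\<Delta> c = \<Sum> c\<^sub>1 \<otimes> c\<^sub>2\<close>.

  The two maps are inverse to each other by one-line computations. For a functional \<open>f\<close>, the counit
  law gives \<open>\<epsilon>(\<Sum> c\<^sub>1 f(c\<^sub>2)) = f(c)\<close> (\<open>counit_rharpoon\<close>). For a bicolinear endomorphism \<open>g\<close>, colinearity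
  turns \<open>\<Sum> c\<^sub>1 \<epsilon>(g(c\<^sub>2))\<close> and \<open>\<Sum> \<epsilon>(g(c\<^sub>1)) c\<^sub>2\<close> into contractions of \<open>\<Delta>(g c)\<close> with \<open>\<epsilon>\<close>, so both equal \<open>g c\<close>
  (\<open>counit_endo\<close>); in particular \<open>\<epsilon> \<circ> g\<close> lies in the centralizer. Conversely, by coassociativity
  \<open>c \<mapsto> c \<leftharpoonup> f\<close> is right colinear and \<open>c \<mapsto> f \<rightharpoonup> c\<close> is left colinear (\<open>comult_lharpoon\<close>,
  \<open>comult_rharpoon\<close>); on the centralizer the two maps coincide, so the common value is bicolinear.

  The multiplicative statements rest on one formula: for bicolinear \<open>g\<close> and \<open>h\<close>,
  \<open>\<Delta>(g(h c)) = (g \<otimes> h)(\<Delta> c) = \<Delta>(h(g c))\<close> (\<open>comult_comp\<close>). Contracting with \<open>\<epsilon>\<close> yields \<open>g \<circ> h = h \<circ> g\<close>, and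
  applying \<open>\<epsilon> \<otimes> \<epsilon>\<close> shows that \<open>g \<mapsto> \<epsilon> \<circ> g\<close> carries composition to the convolution product
  (\<open>convolution_counit\<close>). The algebra laws of the centralizer are then transported along this
  bijection. Finally, an endomorphism \<open>g\<close> preserves each subbicomodule \<open>L\<close>, since
  \<open>g l = \<Sum> l\<^sub>1 \<epsilon>(g(l\<^sub>2))\<close> only involves the coaction of \<open>L\<close> and the right action of \<open>A\<close> on \<open>L\<close>.

  Sigma notation becomes rigorous through the universal property of the tensor product: a balanced
  map induces a unique additive map, namely \<open>tensor_sum\<close> (\<open>tensor_sum_additive\<close>,
  \<open>tensor_sum_tens\<close>), and additive maps that agree on pure tensors are equal (\<open>tensor_ext\<close>).
\<close>

section \<open>Tensor products and balanced maps\<close>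

text \<open>The linear extension of \<open>b\<close> to formal integer combinations; \<open>tensor_sum\<close> is its value at a
  chosen representative of a coset.\<close>

definition frag_sum :: "('p, 'q) ring_scheme \<Rightarrow> ('k \<Rightarrow> 'p) \<Rightarrow> ('k \<Rightarrow>\<^sub>0 int) \<Rightarrow> 'p"
  where "frag_sum P b t = finsum P (\<lambda>k. [Poly_Mapping.lookup t k] \<cdot>\<^bsub>P\<^esub> b k) (Poly_Mapping.keys t)"

context abelian_group
begin

text \<open>Enlarging the index set by keys with coefficient \<open>0\<close> lets the sums belonging to different formal
  combinations run over a common index set, where they can be added termwise.\<close>

lemma frag_sum_superset:
  assumes "b \<in> S \<rightarrow> carrier G" "Poly_Mapping.keys t \<subseteq> K" "K \<subseteq> S" "finite K"
  shows "frag_sum G b t = finsum G (\<lambda>k. [Poly_Mapping.lookup t k] \<cdot> b k) K"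
  unfolding frag_sum_def
  by (rule add.finprod_mono_neutral_cong_left)
     (use assms in \<open>auto simp: in_keys_iff Pi_iff subset_iff add_pow_def intro!: add.int_pow_closed [unfolded add_pow_def]\<close>)

lemma frag_sum_hom:
  assumes b: "b \<in> S \<rightarrow> carrier G"
  shows "frag_sum G b \<in> hom (free_Abelian_group S) (add_monoid G)"
proof (rule homI)
  fix t assume "t \<in> carrier (free_Abelian_group S)"
  then show "frag_sum G b t \<in> carrier (add_monoid G)"
    using b unfolding frag_sum_def by (auto intro!: finsum_closed)
next
  fix s t assume st: "s \<in> carrier (free_Abelian_group S)" "t \<in> carrier (free_Abelian_group S)"
  let ?K = "Poly_Mapping.keys s \<union> Poly_Mapping.keys t"
  have K: "?K \<subseteq> S" "finite ?K" using st by auto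
  have eq: "frag_sum G b u = finsum G (\<lambda>k. [Poly_Mapping.lookup u k] \<cdot> b k) ?K"
    if "Poly_Mapping.keys u \<subseteq> ?K" for u
    using frag_sum_superset [OF b that K] .
  have bK: "b k \<in> carrier G" if "k \<in> ?K" for k using b K that by auto
  have "frag_sum G b (s + t)
      = finsum G (\<lambda>k. [Poly_Mapping.lookup s k] \<cdot> b k \<oplus> [Poly_Mapping.lookup t k] \<cdot> b k) ?K"
    by (subst eq [OF keys_add], rule finsum_cong')
       (use bK in \<open>auto simp: lookup_add add.int_pow_mult\<close>)
  also have "\<dots> = frag_sum G b s \<oplus> frag_sum G b t"
    by (subst finsum_addf) (use bK in \<open>auto simp: eq\<close>)
  finally show "frag_sum G b (s \<otimes>\<^bsub>free_Abelian_group S\<^esub> t)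
      = frag_sum G b s \<otimes>\<^bsub>add_monoid G\<^esub> frag_sum G b t" by simp
qed

lemma frag_sum_of: "b k \<in> carrier G \<Longrightarrow> frag_sum G b (frag_of k) = b k"
  by (simp add: frag_sum_def)

end

definition balanced ::
    "('a, 'q) ring_scheme \<Rightarrow> ('a, 'm, 'x) bimod_scheme \<Rightarrow> ('a, 'n, 'y) bimod_scheme \<Rightarrow>
      ('p, 's) ring_scheme \<Rightarrow> ('m \<Rightarrow> 'n \<Rightarrow> 'p) \<Rightarrow> bool"
  where "balanced A M N P \<beta> \<longleftrightarrow>
    (\<forall>x \<in> carrier M. \<forall>y \<in> carrier N. \<beta> x y \<in> carrier P) \<and>
    (\<forall>x \<in> carrier M. \<forall>x' \<in> carrier M. \<forall>y \<in> carrier N. \<beta> (x \<oplus>\<^bsub>M\<^esub> x') y = \<beta> x y \<oplus>\<^bsub>P\<^esub> \<beta> x' y) \<and>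
    (\<forall>x \<in> carrier M. \<forall>y \<in> carrier N. \<forall>y' \<in> carrier N. \<beta> x (y \<oplus>\<^bsub>N\<^esub> y') = \<beta> x y \<oplus>\<^bsub>P\<^esub> \<beta> x y') \<and>
    (\<forall>x \<in> carrier M. \<forall>a \<in> carrier A. \<forall>y \<in> carrier N. \<beta> (ract M x a) y = \<beta> x (lact N a y))"

lemma balancedI:
  assumes "\<And>x y. \<lbrakk>x \<in> carrier M; y \<in> carrier N\<rbrakk> \<Longrightarrow> \<beta> x y \<in> carrier P"
    and "\<And>x x' y. \<lbrakk>x \<in> carrier M; x' \<in> carrier M; y \<in> carrier N\<rbrakk> \<Longrightarrow>
      \<beta> (x \<oplus>\<^bsub>M\<^esub> x') y = \<beta> x y \<oplus>\<^bsub>P\<^esub> \<beta> x' y"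
    and "\<And>x y y'. \<lbrakk>x \<in> carrier M; y \<in> carrier N; y' \<in> carrier N\<rbrakk> \<Longrightarrow>
      \<beta> x (y \<oplus>\<^bsub>N\<^esub> y') = \<beta> x y \<oplus>\<^bsub>P\<^esub> \<beta> x y'"
    and "\<And>x a y. \<lbrakk>x \<in> carrier M; a \<in> carrier A; y \<in> carrier N\<rbrakk> \<Longrightarrow>
      \<beta> (ract M x a) y = \<beta> x (lact N a y)"
  shows "balanced A M N P \<beta>"
  using assms unfolding balanced_def by blast

text \<open>Only carriers and additions enter. This makes the notion insensitive to the fields with which a
  group is extended: a bimodule, a tensor group and the ring \<open>A\<close> are all treated alike.\<close>

definition additive ::
    "('g, 'x) ring_scheme \<Rightarrow> ('h, 'y) ring_scheme \<Rightarrow> ('g \<Rightarrow> 'h) set"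
  where "additive G H = {f \<in> carrier G \<rightarrow> carrier H.
    \<forall>x \<in> carrier G. \<forall>y \<in> carrier G. f (x \<oplus>\<^bsub>G\<^esub> y) = f x \<oplus>\<^bsub>H\<^esub> f y}"

lemma additive_comp:
  "\<lbrakk>f \<in> additive G H; g \<in> additive H K\<rbrakk> \<Longrightarrow> (\<lambda>x. g (f x)) \<in> additive G K"
  unfolding additive_def by (auto simp: Pi_iff)

lemma additive_id: "(\<lambda>x. x) \<in> additive G G"
  unfolding additive_def by auto

lemma additive_closed: "\<lbrakk>f \<in> additive G H; x \<in> carrier G\<rbrakk> \<Longrightarrow> f x \<in> carrier H"
  by (auto simp: additive_def)

lemma additive_add:
  "\<lbrakk>f \<in> additive G H; x \<in> carrier G; y \<in> carrier G\<rbrakk> \<Longrightarrow> f (x \<oplus>\<^bsub>G\<^esub> y) = f x \<oplus>\<^bsub>H\<^esub> f y"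
  by (auto simp: additive_def)

lemma additive_sum:
  assumes "abelian_group H" "p \<in> additive G H" "q \<in> additive G H"
  shows "(\<lambda>x. p x \<oplus>\<^bsub>H\<^esub> q x) \<in> additive G H"
proof -
  interpret H: abelian_group H by fact
  show ?thesis
    using assms(2,3) by (auto simp: additive_def Pi_iff H.a_ac)
qed

lemma additive_zero:
  assumes "abelian_group G" "abelian_group H" and f: "f \<in> additive G H"
  shows "f \<zero>\<^bsub>G\<^esub> = \<zero>\<^bsub>H\<^esub>"
proof -
  interpret G: abelian_group G by fact
  interpret H: abelian_group H by fact
  have "f \<zero>\<^bsub>G\<^esub> \<oplus>\<^bsub>H\<^esub> f \<zero>\<^bsub>G\<^esub> = f \<zero>\<^bsub>G\<^esub>"
    using additive_add [OF f G.zero_closed G.zero_closed] by simp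
  then show ?thesis
    using additive_closed [OF f G.zero_closed] by (simp add: H.add.r_cancel_one')
qed

locale tensor_factors = M: right_module A M + N: left_module A N for A and M and N
begin

abbreviation F where "F \<equiv> tensor_free M N"
abbreviation K where "K \<equiv> tensor_rel A M N"
abbreviation T where "T \<equiv> tensor_group A M N"

sublocale F: comm_group F
  unfolding tensor_free_def by (rule abelian_free_Abelian_group)

lemma F_simps [simp]:
  "t \<in> carrier F \<longleftrightarrow> Poly_Mapping.keys t \<subseteq> carrier M \<times> carrier N"
  "s \<otimes>\<^bsub>F\<^esub> t = s + t" "\<one>\<^bsub>F\<^esub> = 0"
  "Poly_Mapping.keys t \<subseteq> carrier M \<times> carrier N \<Longrightarrow> inv\<^bsub>F\<^esub> t = - t"
  by (simp_all add: tensor_free_def)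

lemma keys_frag_add_sub:
  "\<lbrakk>Poly_Mapping.keys s \<subseteq> S; Poly_Mapping.keys t \<subseteq> S\<rbrakk> \<Longrightarrow> Poly_Mapping.keys (s + t) \<subseteq> S"
  "\<lbrakk>Poly_Mapping.keys s \<subseteq> S; Poly_Mapping.keys t \<subseteq> S\<rbrakk> \<Longrightarrow> Poly_Mapping.keys (s - t) \<subseteq> S"
  using keys_add [of s t] keys_diff [of s t] by auto

lemma rel_subgroup: "subgroup K F"
  unfolding tensor_rel_def
proof (rule F.generate_is_subgroup, safe, goal_cases)
qed (use M.M.a_closed N.M.a_closed M.ract_closed N.lact_closed in
     \<open>auto intro!: keys_frag_add_sub simp: subset_iff dest!: subsetD [OF keys_diff] split: if_splits\<close>)

lemma rel_normal: "K \<lhd> F"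
  by (simp add: F.subgroup_imp_normal rel_subgroup)

lemma carrier_tensor_group: "carrier T = (\<lambda>t. K #>\<^bsub>F\<^esub> t) ` carrier F"
  by (auto simp: tensor_group_def RCOSETS_def)

lemma tensor_group_simps:
  "add T = set_mult F" "zero T = K"
  by (simp_all add: tensor_group_def)

lemma tensor_group_abelian: "abelian_group T"
proof (rule comm_group_abelian_groupI)
  have "add_monoid T = F Mod K" by (simp add: tensor_group_def FactGroup_def)
  then show "comm_group (add_monoid T)" using F.abelian_FactGroup [OF rel_subgroup] by simp
qed

sublocale T: abelian_group T by (rule tensor_group_abelian)

lemma coset_add:
  "\<lbrakk>s \<in> carrier F; t \<in> carrier F\<rbrakk> \<Longrightarrow> (K #>\<^bsub>F\<^esub> s) \<oplus>\<^bsub>T\<^esub> (K #>\<^bsub>F\<^esub> t) = K #>\<^bsub>F\<^esub> (s + t)"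
  using normal.rcos_sum [OF rel_normal, of s t] by (simp add: tensor_group_simps)

lemma coset_eqI:
  assumes "s - t \<in> K" "s \<in> carrier F" "t \<in> carrier F"
  shows "K #>\<^bsub>F\<^esub> s = K #>\<^bsub>F\<^esub> t"
proof -
  have "s \<in> K #>\<^bsub>F\<^esub> t"
    using assms by (auto simp: r_coset_def intro!: bexI [of _ "s - t"])
  then show ?thesis using F.repr_independence [OF _ assms(3) rel_subgroup] by simp
qed

lemma tens_closed: "\<lbrakk>x \<in> carrier M; y \<in> carrier N\<rbrakk> \<Longrightarrow> tens A M N x y \<in> carrier T"
  unfolding carrier_tensor_group tens_def by auto

lemma tens_balanced: "balanced A M N T (tens A M N)"
proof (rule balancedI)
  note c = M.M.a_closed N.M.a_closed M.ract_closed N.lact_closed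
  { fix x y assume "x \<in> carrier M" "y \<in> carrier N"
    then show "tens A M N x y \<in> carrier T" by (rule tens_closed) }
  { fix x x' y assume xy: "x \<in> carrier M" "x' \<in> carrier M" "y \<in> carrier N"
    have "frag_of (x \<oplus>\<^bsub>M\<^esub> x', y) - (frag_of (x, y) + frag_of (x', y)) \<in> K"
      unfolding tensor_rel_def diff_diff_eq [symmetric]
      by (rule generate.incl) (use xy in blast)
    with xy show "tens A M N (x \<oplus>\<^bsub>M\<^esub> x') y = tens A M N x y \<oplus>\<^bsub>T\<^esub> tens A M N x' y"
      unfolding tens_def by (subst coset_add) (simp_all add: coset_eqI keys_frag_add_sub c) }
  { fix x y y' assume xy: "x \<in> carrier M" "y \<in> carrier N" "y' \<in> carrier N"
    have "frag_of (x, y \<oplus>\<^bsub>N\<^esub> y') - (frag_of (x, y) + frag_of (x, y')) \<in> K"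
      unfolding tensor_rel_def diff_diff_eq [symmetric]
      by (rule generate.incl) (use xy in blast)
    with xy show "tens A M N x (y \<oplus>\<^bsub>N\<^esub> y') = tens A M N x y \<oplus>\<^bsub>T\<^esub> tens A M N x y'"
      unfolding tens_def by (subst coset_add) (simp_all add: coset_eqI keys_frag_add_sub c) }
  { fix x a y assume xy: "x \<in> carrier M" "a \<in> carrier A" "y \<in> carrier N"
    have "frag_of (ract M x a, y) - frag_of (x, lact N a y) \<in> K"
      unfolding tensor_rel_def
      by (rule generate.incl) (use xy in blast)
    with xy show "tens A M N (ract M x a) y = tens A M N x (lact N a y)"
      unfolding tens_def by (simp add: coset_eqI c) }
qed

lemmas tens_add_left = tens_balanced [unfolded balanced_def, THEN conjunct2, THEN conjunct1, rule_format]
lemmas tens_add_right =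
  tens_balanced [unfolded balanced_def, THEN conjunct2, THEN conjunct2, THEN conjunct1, rule_format]
lemmas tens_middle =
  tens_balanced [unfolded balanced_def, THEN conjunct2, THEN conjunct2, THEN conjunct2, rule_format]

lemma tens_zero_left:
  assumes "y \<in> carrier N"
  shows "tens A M N \<zero>\<^bsub>M\<^esub> y = \<zero>\<^bsub>T\<^esub>"
proof -
  have "tens A M N \<zero>\<^bsub>M\<^esub> y \<oplus>\<^bsub>T\<^esub> tens A M N \<zero>\<^bsub>M\<^esub> y = tens A M N \<zero>\<^bsub>M\<^esub> y"
    using assms tens_add_left [of "\<zero>\<^bsub>M\<^esub>" "\<zero>\<^bsub>M\<^esub>" y] by simp
  then show ?thesis using assms tens_closed [of "\<zero>\<^bsub>M\<^esub>" y] by (simp add: T.add.r_cancel_one')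
qed

text \<open>Negatives need no clause, since \<open>-(x \<otimes> y) = (-x) \<otimes> y\<close>.\<close>

lemma tensor_induct [consumes 1, case_names tens add]:
  assumes u: "u \<in> carrier T"
    and tens: "\<And>x y. \<lbrakk>x \<in> carrier M; y \<in> carrier N\<rbrakk> \<Longrightarrow> P (tens A M N x y)"
    and add: "\<And>u v. \<lbrakk>u \<in> carrier T; v \<in> carrier T; P u; P v\<rbrakk> \<Longrightarrow> P (u \<oplus>\<^bsub>T\<^esub> v)"
  shows "P u"
proof -
  obtain t where t: "Poly_Mapping.keys t \<subseteq> carrier M \<times> carrier N" "u = K #>\<^bsub>F\<^esub> t"
    using u by (auto simp: carrier_tensor_group)
  have "P (K #>\<^bsub>F\<^esub> t) \<and> P (K #>\<^bsub>F\<^esub> (- t))"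
    using t(1)
  proof (induction t rule: free_Abelian_group_induct [consumes 1, case_names zero diff of])
    case zero
    have "K #>\<^bsub>F\<^esub> 0 = \<zero>\<^bsub>T\<^esub>"
      using F.coset_join2 [of 0 K] subgroup.one_closed [OF rel_subgroup] rel_subgroup
      by (simp add: tensor_group_simps)
    also have "\<dots> = tens A M N \<zero>\<^bsub>M\<^esub> \<zero>\<^bsub>N\<^esub>" by (simp add: tens_zero_left)
    finally show ?case using tens [of "\<zero>\<^bsub>M\<^esub>" "\<zero>\<^bsub>N\<^esub>"] by simp
  next
    case (diff s t)
    have c: "K #>\<^bsub>F\<^esub> w \<in> carrier T" if "Poly_Mapping.keys w \<subseteq> carrier M \<times> carrier N" for w
      using that by (auto simp: carrier_tensor_group)
    have "P ((K #>\<^bsub>F\<^esub> s) \<oplus>\<^bsub>T\<^esub> (K #>\<^bsub>F\<^esub> (- t)))" "P ((K #>\<^bsub>F\<^esub> t) \<oplus>\<^bsub>T\<^esub> (K #>\<^bsub>F\<^esub> (- s)))"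
      using diff by (auto intro!: add c)
    then show ?case using diff by (simp add: coset_add)
  next
    case (of k)
    obtain x y where k: "k = (x, y)" "x \<in> carrier M" "y \<in> carrier N" using of by auto
    let ?z = "tens A M N (\<ominus>\<^bsub>M\<^esub> x) y"
    have "tens A M N x y \<oplus>\<^bsub>T\<^esub> ?z = \<zero>\<^bsub>T\<^esub>"
      using k tens_add_left [of x "\<ominus>\<^bsub>M\<^esub> x" y] by (simp add: M.M.r_neg tens_zero_left)
    moreover have "tens A M N x y \<oplus>\<^bsub>T\<^esub> (K #>\<^bsub>F\<^esub> (- frag_of k)) = \<zero>\<^bsub>T\<^esub>"
      unfolding tens_def k
      using k F.coset_join2 [of 0 K] subgroup.one_closed [OF rel_subgroup] rel_subgroup
      by (subst coset_add) (auto simp: tensor_group_simps)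
    moreover have "K #>\<^bsub>F\<^esub> (- frag_of k) \<in> carrier T"
      using k by (auto simp: carrier_tensor_group)
    ultimately have "K #>\<^bsub>F\<^esub> (- frag_of k) = ?z"
      using k tens_closed [of x y] tens_closed [of "\<ominus>\<^bsub>M\<^esub> x" y]
      by (metis M.M.a_inv_closed T.a_comm T.minus_equality)
    moreover have "K #>\<^bsub>F\<^esub> (frag_of k) = tens A M N x y" by (simp add: tens_def k)
    ultimately show ?case using tens k by simp
  qed
  then show ?thesis using t by simp
qed

text \<open>All identities between maps out of a tensor product below are reduced to pure tensors by this
  principle.\<close>

lemma tensor_ext:
  assumes "f \<in> additive T P" "g \<in> additive T P"
    and "\<And>x y. \<lbrakk>x \<in> carrier M; y \<in> carrier N\<rbrakk> \<Longrightarrow> f (tens A M N x y) = g (tens A M N x y)"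
    and "u \<in> carrier T"
  shows "f u = g u"
  using assms(4)
  by (induction u rule: tensor_induct) (use assms(1-3) in \<open>simp_all add: additive_def\<close>)

text \<open>The value of \<open>tensor_sum\<close> is independent of the representative picked by the choice operator: the
  linear extension of a balanced map sends each of the three kinds of generators of the relation
  subgroup to zero, hence is constant on cosets.\<close>

lemma tensor_sum_coset:
  assumes "abelian_group P" and \<beta>: "balanced A M N P \<beta>" and t: "t \<in> carrier F"
  shows "tensor_sum P \<beta> (K #>\<^bsub>F\<^esub> t) = frag_sum P (\<lambda>k. \<beta> (fst k) (snd k)) t"
proof -
  interpret P: abelian_group P by fact
  let ?b = "\<lambda>k. \<beta> (fst k) (snd k)"
  let ?E = "frag_sum P ?b"
  have b: "?b \<in> carrier M \<times> carrier N \<rightarrow> carrier P" using \<beta> by (auto simp: balanced_def)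
  have E: "?E \<in> hom F (add_monoid P)"
    unfolding tensor_free_def by (rule P.frag_sum_hom [OF b])
  interpret E: group_hom F "add_monoid P" ?E
    by (simp add: group_hom_def group_hom_axioms_def E P.a_group F.group_axioms)
  have [simp]: "?E (frag_of (x, y)) = \<beta> x y" if "x \<in> carrier M" "y \<in> carrier N" for x y
    using \<beta> that P.frag_sum_of [of ?b "(x, y)"] by (simp add: balanced_def)
  have E_diff: "?E (v - w) = ?E v \<ominus>\<^bsub>P\<^esub> ?E w"
    if "Poly_Mapping.keys v \<subseteq> carrier M \<times> carrier N" "Poly_Mapping.keys w \<subseteq> carrier M \<times> carrier N" for v w
    using E.hom_mult [of v "- w"] E.hom_inv [of w] that by (simp add: a_minus_def a_inv_def)
  note c = M.M.a_closed N.M.a_closed M.ract_closed N.lact_closed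
  have bal: "\<And>x y. \<lbrakk>x \<in> carrier M; y \<in> carrier N\<rbrakk> \<Longrightarrow> \<beta> x y \<in> carrier P"
    "\<And>x x' y. \<lbrakk>x \<in> carrier M; x' \<in> carrier M; y \<in> carrier N\<rbrakk> \<Longrightarrow> \<beta> (x \<oplus>\<^bsub>M\<^esub> x') y = \<beta> x y \<oplus>\<^bsub>P\<^esub> \<beta> x' y"
    "\<And>x y y'. \<lbrakk>x \<in> carrier M; y \<in> carrier N; y' \<in> carrier N\<rbrakk> \<Longrightarrow> \<beta> x (y \<oplus>\<^bsub>N\<^esub> y') = \<beta> x y \<oplus>\<^bsub>P\<^esub> \<beta> x y'"
    "\<And>x a y. \<lbrakk>x \<in> carrier M; a \<in> carrier A; y \<in> carrier N\<rbrakk> \<Longrightarrow> \<beta> (ract M x a) y = \<beta> x (lact N a y)"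
    using \<beta> unfolding balanced_def by blast+
  have cancel: "p \<oplus>\<^bsub>P\<^esub> q \<ominus>\<^bsub>P\<^esub> p \<ominus>\<^bsub>P\<^esub> q = \<zero>\<^bsub>P\<^esub>" if "p \<in> carrier P" "q \<in> carrier P" for p q
    using that by (simp add: P.a_comm [of p q] a_minus_def P.a_assoc P.r_neg)
  have sub: "K \<subseteq> kernel F (add_monoid P) ?E"
    unfolding tensor_rel_def
  proof (rule F.generate_subgroup_incl [OF _ E.subgroup_kernel], safe, goal_cases)
    case (1 x x' y)
    then show ?case
      by (simp add: kernel_def E_diff keys_frag_add_sub c bal)
         (simp add: cancel bal)
  next
    case (2 x y y')
    then show ?case
      by (simp add: kernel_def E_diff keys_frag_add_sub c bal)
         (simp add: cancel bal)
  next
    case (3 x a y)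
    then show ?case
      by (simp add: kernel_def E_diff keys_frag_add_sub c bal)
         (simp add: a_minus_def P.r_neg c bal)
  qed
  let ?u = "SOME u. u \<in> K #>\<^bsub>F\<^esub> t"
  have "?u \<in> K #>\<^bsub>F\<^esub> t"
    using F.rcos_self [OF t rel_subgroup] by (rule someI)
  then obtain r where r: "r \<in> K" "?u = r + t" by (auto simp: r_coset_def)
  have "?E ?u = ?E r \<oplus>\<^bsub>P\<^esub> ?E t"
    using r sub t E.hom_mult [of r t] by (auto simp: kernel_def)
  also have "\<dots> = ?E t" using r sub t E.hom_closed [of t] by (auto simp: kernel_def)
  finally show ?thesis unfolding tensor_sum_def frag_sum_def Let_def .
qed

lemma tensor_sum_additive:
  assumes P: "abelian_group P" and \<beta>: "balanced A M N P \<beta>"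
  shows "tensor_sum P \<beta> \<in> additive T P"
proof -
  let ?b = "\<lambda>k. \<beta> (fst k) (snd k)"
  have b: "?b \<in> carrier M \<times> carrier N \<rightarrow> carrier P" using \<beta> by (auto simp: balanced_def)
  have "frag_sum P ?b \<in> hom F (add_monoid P)"
    unfolding tensor_free_def by (rule abelian_group.frag_sum_hom [OF P b])
  then show ?thesis
    unfolding additive_def carrier_tensor_group
    by (auto simp: coset_add tensor_sum_coset [OF P \<beta>] keys_frag_add_sub hom_def Pi_iff)
qed

lemma tensor_sum_tens:
  assumes P: "abelian_group P" and \<beta>: "balanced A M N P \<beta>" and xy: "x \<in> carrier M" "y \<in> carrier N"
  shows "tensor_sum P \<beta> (tens A M N x y) = \<beta> x y"
proof -
  have "\<beta> x y \<in> carrier P" using \<beta> xy by (auto simp: balanced_def)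
  then show ?thesis
    unfolding tens_def using xy
    by (simp add: tensor_sum_coset [OF P \<beta>] abelian_group.frag_sum_of [OF P])
qed

end

section \<open>The bimodule structure of a tensor product\<close>

lemma tensor_bimod_simps [simp]:
  "carrier (tensor_bimod A M N) = carrier (tensor_group A M N)"
  "zero (tensor_bimod A M N) = zero (tensor_group A M N)"
  "add (tensor_bimod A M N) = add (tensor_group A M N)"
  by (simp_all add: tensor_bimod_def ring.defs bimod.defs)

lemma tensor_bimod_act:
  "lact (tensor_bimod A M N) a =
     tensor_sum (tensor_group A M N) (\<lambda>x y. tens A M N (lact M a x) y)"
  "ract (tensor_bimod A M N) u a =
     tensor_sum (tensor_group A M N) (\<lambda>x y. tens A M N x (ract N y a)) u"
  by (simp_all add: tensor_bimod_def ring.defs bimod.defs)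

locale bimodule_pair = M: bimodule R A M + N: bimodule R A N for R and A and M and N
begin

sublocale TF: tensor_factors A M N
  by (simp add: tensor_factors_def M.right_module_axioms N.left_module_axioms)

abbreviation T where "T \<equiv> tensor_group A M N"
abbreviation B where "B \<equiv> tensor_bimod A M N"

text \<open>Acting on the outer side of each factor is compatible with moving scalars across the tensor sign
  because the two actions on a bimodule commute.\<close>

lemma lact_balanced:
  "a \<in> carrier A \<Longrightarrow> balanced A M N T (\<lambda>x y. tens A M N (lact M a x) y)"
  by (rule balancedI)
     (simp_all add: TF.tens_closed TF.tens_add_left TF.tens_add_right M.lact_closed M.ract_closed
       N.lact_closed M.lact_add M.lact_ract [symmetric] TF.tens_middle)

lemma ract_balanced:
  "a \<in> carrier A \<Longrightarrow> balanced A M N T (\<lambda>x y. tens A M N x (ract N y a))"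
  by (rule balancedI)
     (simp_all add: TF.tens_closed TF.tens_add_left TF.tens_add_right M.ract_closed N.ract_closed
       N.lact_closed N.ract_add N.lact_ract TF.tens_middle)

lemma lact_additive: "a \<in> carrier A \<Longrightarrow> lact B a \<in> additive T T"
  using TF.tensor_sum_additive [OF TF.tensor_group_abelian lact_balanced] by (simp add: tensor_bimod_act)

lemma ract_additive: "a \<in> carrier A \<Longrightarrow> (\<lambda>u. ract B u a) \<in> additive T T"
  using TF.tensor_sum_additive [OF TF.tensor_group_abelian ract_balanced] by (simp add: tensor_bimod_act)

lemma lact_tens:
  "\<lbrakk>a \<in> carrier A; x \<in> carrier M; y \<in> carrier N\<rbrakk> \<Longrightarrow>
    lact B a (tens A M N x y) = tens A M N (lact M a x) y"
  using TF.tensor_sum_tens [OF TF.tensor_group_abelian lact_balanced] by (simp add: tensor_bimod_act)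

lemma ract_tens:
  "\<lbrakk>a \<in> carrier A; x \<in> carrier M; y \<in> carrier N\<rbrakk> \<Longrightarrow>
    ract B (tens A M N x y) a = tens A M N x (ract N y a)"
  using TF.tensor_sum_tens [OF TF.tensor_group_abelian ract_balanced] by (simp add: tensor_bimod_act)

lemma tensor_bimod_abelian: "abelian_group B"
proof (rule abelian_groupI)
  show "\<exists>v \<in> carrier B. v \<oplus>\<^bsub>B\<^esub> u = \<zero>\<^bsub>B\<^esub>" if "u \<in> carrier B" for u
    using that by (intro bexI [of _ "\<ominus>\<^bsub>T\<^esub> u"]) (simp_all add: TF.T.l_neg)
  show "u \<oplus>\<^bsub>B\<^esub> v = v \<oplus>\<^bsub>B\<^esub> u" if "u \<in> carrier B" "v \<in> carrier B" for u v
    using TF.T.a_comm [of u v] that by simp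
qed (simp_all add: TF.T.a_assoc)

text \<open>Every bimodule law is an equation between additive maps, and on pure tensors it is the same law
  in one of the factors.\<close>

lemma tensor_bimod_bimodule: "bimodule R A B"
proof -
  note ad = lact_additive ract_additive
  note cl [simp] = TF.tens_closed M.lact_closed M.ract_closed N.lact_closed N.ract_closed
    TF.T.a_closed additive_closed [OF lact_additive] additive_closed [OF ract_additive]
    lact_tens ract_tens additive_add [OF lact_additive] additive_add [OF ract_additive]
  have lm: "left_module A B"
  proof (intro left_module.intro left_module_axioms.intro)
    show "ring A" by (rule left_module.axioms(1) [OF M.left_module_axioms])
    show "abelian_group B" by (rule tensor_bimod_abelian)
    fix a b u v assume a: "a \<in> carrier A"
    { assume "u \<in> carrier B" then show "lact B a u \<in> carrier B" using a by simp }
    { assume "u \<in> carrier B" "v \<in> carrier B"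
      then show "lact B a (u \<oplus>\<^bsub>B\<^esub> v) = lact B a u \<oplus>\<^bsub>B\<^esub> lact B a v" using a by simp }
    assume b: "b \<in> carrier A" and "u \<in> carrier B"
    then have u: "u \<in> carrier T" by simp
    from u show "lact B (a \<oplus>\<^bsub>A\<^esub> b) u = lact B a u \<oplus>\<^bsub>B\<^esub> lact B b u"
      by (induction u rule: TF.tensor_induct)
         (use a b in \<open>simp_all add: M.lact_add_scalar TF.tens_add_left TF.T.a_ac\<close>)
    from u show "lact B (a \<otimes>\<^bsub>A\<^esub> b) u = lact B a (lact B b u)"
      by (induction u rule: TF.tensor_induct) (use a b in \<open>simp_all add: M.lact_mult\<close>)
  next
    fix u assume "u \<in> carrier B"
    then have "u \<in> carrier T" by simp
    then show "lact B \<one>\<^bsub>A\<^esub> u = u"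
      by (induction u rule: TF.tensor_induct) (simp_all add: M.lact_one)
  qed
  have rm: "right_module A B"
  proof (intro right_module.intro right_module_axioms.intro)
    show "ring A" by (rule left_module.axioms(1) [OF M.left_module_axioms])
    show "abelian_group B" by (rule tensor_bimod_abelian)
    fix a b u v assume a: "a \<in> carrier A"
    { assume "u \<in> carrier B" then show "ract B u a \<in> carrier B" using a by simp }
    { assume "u \<in> carrier B" "v \<in> carrier B"
      then show "ract B (u \<oplus>\<^bsub>B\<^esub> v) a = ract B u a \<oplus>\<^bsub>B\<^esub> ract B v a" using a by simp }
    assume b: "b \<in> carrier A" and "u \<in> carrier B"
    then have u: "u \<in> carrier T" by simp
    from u show "ract B u (a \<oplus>\<^bsub>A\<^esub> b) = ract B u a \<oplus>\<^bsub>B\<^esub> ract B u b"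
      by (induction u rule: TF.tensor_induct)
         (use a b in \<open>simp_all add: N.ract_add_scalar TF.tens_add_right TF.T.a_ac\<close>)
    from u show "ract B u (a \<otimes>\<^bsub>A\<^esub> b) = ract B (ract B u a) b"
      by (induction u rule: TF.tensor_induct) (use a b in \<open>simp_all add: N.ract_mult\<close>)
  next
    fix u assume "u \<in> carrier B"
    then have "u \<in> carrier T" by simp
    then show "ract B u \<one>\<^bsub>A\<^esub> = u"
      by (induction u rule: TF.tensor_induct) (simp_all add: N.ract_one)
  qed
  have "bimodule_axioms R A B"
  proof (intro bimodule_axioms.intro)
    fix a b u assume ab: "a \<in> carrier A" "b \<in> carrier A" and "u \<in> carrier B"
    then have u: "u \<in> carrier T" by simp
    then show "ract B (lact B a u) b = lact B a (ract B u b)"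
      by (induction u rule: TF.tensor_induct) (use ab in simp_all)
  next
    fix r u assume r: "r \<in> carrier R" and "u \<in> carrier B"
    then have u: "u \<in> carrier T" by simp
    have r1: "r \<odot>\<^bsub>A\<^esub> \<one>\<^bsub>A\<^esub> \<in> carrier A" using r by (simp add: M.smult_closed)
    from u show "lact B (r \<odot>\<^bsub>A\<^esub> \<one>\<^bsub>A\<^esub>) u = ract B u (r \<odot>\<^bsub>A\<^esub> \<one>\<^bsub>A\<^esub>)"
      by (induction u rule: TF.tensor_induct)
         (use r r1 in \<open>simp_all add: M.central TF.tens_middle N.central\<close>)
  qed
  with lm rm show ?thesis by (intro bimodule.intro) (rule M.assoc_algebra_axioms)
qed

end

section \<open>Tensor products of maps and associativity\<close>

lemma bimod_homD:
  assumes "f \<in> bimod_hom A M N"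
  shows "f \<in> left_hom A M N" "f \<in> right_hom A M N" "f \<in> additive M N"
    and "\<And>x. x \<in> carrier M \<Longrightarrow> f x \<in> carrier N"
    and "\<And>x y. \<lbrakk>x \<in> carrier M; y \<in> carrier M\<rbrakk> \<Longrightarrow> f (x \<oplus>\<^bsub>M\<^esub> y) = f x \<oplus>\<^bsub>N\<^esub> f y"
    and "\<And>a x. \<lbrakk>a \<in> carrier A; x \<in> carrier M\<rbrakk> \<Longrightarrow> f (lact M a x) = lact N a (f x)"
    and "\<And>a x. \<lbrakk>a \<in> carrier A; x \<in> carrier M\<rbrakk> \<Longrightarrow> f (ract M x a) = ract N (f x) a"
  using assms by (auto simp: bimod_hom_def left_hom_def right_hom_def additive_def)

lemma bimod_homI:
  assumes "f \<in> additive M N"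
    and "\<And>a x. \<lbrakk>a \<in> carrier A; x \<in> carrier M\<rbrakk> \<Longrightarrow> f (lact M a x) = lact N a (f x)"
    and "\<And>a x. \<lbrakk>a \<in> carrier A; x \<in> carrier M\<rbrakk> \<Longrightarrow> f (ract M x a) = ract N (f x) a"
  shows "f \<in> bimod_hom A M N"
  using assms by (auto simp: bimod_hom_def left_hom_def right_hom_def additive_def)

lemma bimod_hom_comp:
  assumes f: "f \<in> bimod_hom A L M" and g: "g \<in> bimod_hom A M N"
  shows "(\<lambda>x. g (f x)) \<in> bimod_hom A L N"
  by (rule bimod_homI [OF additive_comp [OF bimod_homD(3) [OF f] bimod_homD(3) [OF g]]])
     (simp_all add: bimod_homD [OF f] bimod_homD [OF g])

lemma bimod_hom_id: "(\<lambda>x. x) \<in> bimod_hom A M M" "id \<in> bimod_hom A M M"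
  by (auto intro!: bimod_homI simp: additive_def)

lemma tensor_map_balanced:
  assumes "tensor_factors A M N" "tensor_factors A M' N'"
    and "f \<in> right_hom A M M'" "g \<in> left_hom A N N'"
  shows "balanced A M N (tensor_group A M' N') (\<lambda>x y. tens A M' N' (f x) (g y))"
proof -
  interpret T': tensor_factors A M' N' by fact
  show ?thesis
    by (rule balancedI)
       (use assms(3,4) in \<open>auto simp: right_hom_def left_hom_def Pi_iff T'.tens_closed T'.tens_add_left
          T'.tens_add_right T'.tens_middle\<close>)
qed

lemma tensor_map_additive:
  assumes "tensor_factors A M N" "tensor_factors A M' N'"
    and "f \<in> right_hom A M M'" "g \<in> left_hom A N N'"
  shows "tensor_map A M' N' f g \<in> additive (tensor_group A M N) (tensor_group A M' N')"
  unfolding tensor_map_def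
  by (rule tensor_factors.tensor_sum_additive [OF assms(1)
        tensor_factors.tensor_group_abelian [OF assms(2)] tensor_map_balanced [OF assms]])

lemma tensor_map_tens:
  assumes "tensor_factors A M N" "tensor_factors A M' N'"
    and "f \<in> right_hom A M M'" "g \<in> left_hom A N N'" "x \<in> carrier M" "y \<in> carrier N"
  shows "tensor_map A M' N' f g (tens A M N x y) = tens A M' N' (f x) (g y)"
  unfolding tensor_map_def
  by (rule tensor_factors.tensor_sum_tens [OF assms(1)
        tensor_factors.tensor_group_abelian [OF assms(2)] tensor_map_balanced [OF assms(1-4)] assms(5,6)])

locale bimodule_triple =
  M: bimodule R A M + N: bimodule R A N + P: bimodule R A P for R and A and M and N and P
begin

sublocale MN: bimodule_pair R A M N
  by (simp add: bimodule_pair_def M.bimodule_axioms N.bimodule_axioms)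
sublocale NP: bimodule_pair R A N P
  by (simp add: bimodule_pair_def P.bimodule_axioms N.bimodule_axioms)
sublocale MN_P: bimodule_pair R A "tensor_bimod A M N" P
  by (simp add: bimodule_pair_def P.bimodule_axioms MN.tensor_bimod_bimodule)
sublocale M_NP: bimodule_pair R A M "tensor_bimod A N P"
  by (simp add: bimodule_pair_def M.bimodule_axioms NP.tensor_bimod_bimodule)

abbreviation G where "G \<equiv> tensor_group A M (tensor_bimod A N P)"

text \<open>The inner sum in the definition of \<open>tensor_assoc\<close>: for a fixed third factor \<open>z\<close> it sends
  \<open>x \<otimes> y\<close> to \<open>x \<otimes> (y \<otimes> z)\<close>.\<close>

abbreviation assoc_at where
  "assoc_at z \<equiv> tensor_sum G (\<lambda>x y. tens A M (tensor_bimod A N P) x (tens A N P y z))"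

lemma assoc_at_balanced:
  "z \<in> carrier P \<Longrightarrow> balanced A M N G (\<lambda>x y. tens A M (tensor_bimod A N P) x (tens A N P y z))"
  by (rule balancedI)
     (simp_all add: M_NP.TF.tens_closed M_NP.TF.tens_add_left M_NP.TF.tens_add_right [simplified] M_NP.TF.tens_middle
       NP.TF.tens_closed NP.TF.tens_add_left NP.lact_tens M.ract_closed N.lact_closed)

lemma assoc_at_additive: "z \<in> carrier P \<Longrightarrow> assoc_at z \<in> additive (tensor_group A M N) G"
  by (rule MN.TF.tensor_sum_additive [OF M_NP.TF.tensor_group_abelian assoc_at_balanced])

lemma assoc_at_tens:
  "\<lbrakk>z \<in> carrier P; x \<in> carrier M; y \<in> carrier N\<rbrakk> \<Longrightarrow>
    assoc_at z (tens A M N x y) = tens A M (tensor_bimod A N P) x (tens A N P y z)"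
  by (rule MN.TF.tensor_sum_tens [OF M_NP.TF.tensor_group_abelian assoc_at_balanced])

lemma tensor_assoc_balanced:
  "balanced A (tensor_bimod A M N) P G (\<lambda>t z. assoc_at z t)"
proof (rule balancedI)
  note P_closed = abelian_monoid.a_closed
    [OF abelian_group.axioms(1) [OF left_module.axioms(2) [OF P.left_module_axioms]]]
  note cl [simp] = MN.TF.tens_closed M.ract_closed M.lact_closed N.lact_closed N.ract_closed P.lact_closed
    NP.TF.tens_closed M_NP.TF.tens_closed additive_closed [OF assoc_at_additive]
    additive_closed [OF MN.ract_additive] additive_add [OF MN.ract_additive]
    MN.ract_tens assoc_at_tens additive_add [OF assoc_at_additive]
  fix u z assume "u \<in> carrier (tensor_bimod A M N)" and z: "z \<in> carrier P"
  then have u: "u \<in> carrier (tensor_group A M N)" by simp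
  { show "assoc_at z u \<in> carrier G" using u z by simp }
  { fix u' assume "u' \<in> carrier (tensor_bimod A M N)"
    then show "assoc_at z (u \<oplus>\<^bsub>tensor_bimod A M N\<^esub> u') = assoc_at z u \<oplus>\<^bsub>G\<^esub> assoc_at z u'"
      using u z by simp }
  { fix z' assume z': "z' \<in> carrier P"
    from u show "assoc_at (z \<oplus>\<^bsub>P\<^esub> z') u = assoc_at z u \<oplus>\<^bsub>G\<^esub> assoc_at z' u"
      by (induction u rule: MN.TF.tensor_induct)
         (use z z' in \<open>simp_all add: P_closed NP.TF.tens_add_right M_NP.TF.tens_add_right [simplified]
            M_NP.TF.T.a_ac\<close>) }
  { fix a assume a: "a \<in> carrier A"
    from u show "assoc_at z (ract (tensor_bimod A M N) u a) = assoc_at (lact P a z) u"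
      by (induction u rule: MN.TF.tensor_induct) (use a z in \<open>simp_all add: NP.TF.tens_middle\<close>) }
qed

lemma tensor_assoc_additive:
  "tensor_assoc A M N P \<in> additive (tensor_group A (tensor_bimod A M N) P) G"
  unfolding tensor_assoc_def Let_def
  by (rule MN_P.TF.tensor_sum_additive [OF M_NP.TF.tensor_group_abelian tensor_assoc_balanced])

lemma tensor_assoc_tens:
  "\<lbrakk>u \<in> carrier (tensor_group A M N); z \<in> carrier P\<rbrakk> \<Longrightarrow>
    tensor_assoc A M N P (tens A (tensor_bimod A M N) P u z) = assoc_at z u"
  unfolding tensor_assoc_def Let_def
  using MN_P.TF.tensor_sum_tens [OF M_NP.TF.tensor_group_abelian tensor_assoc_balanced, of u z] by simp

end

section \<open>Contracting a tensor with a functional\<close>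

context A_coring
begin

sublocale CCC: bimodule_triple R A C C C
  by (simp add: bimodule_triple_def bimodule_axioms)

abbreviation CC where "CC \<equiv> tensor_bimod A C C"
abbreviation TC where "TC \<equiv> tensor_group A C C"

lemma C_abelian: "abelian_group C"
  by (rule left_module.axioms(2) [OF left_module_axioms])

lemma A_ring: "ring A"
  by (rule left_module.axioms(1) [OF left_module_axioms])

lemmas C_ac = abelian_monoid.a_ac [OF abelian_group.axioms(1) [OF C_abelian]]
lemmas C_closed = abelian_monoid.a_closed [OF abelian_group.axioms(1) [OF C_abelian]]

lemmas comult_simps = bimod_homD [OF comult_hom, simplified]

text \<open>The bilinear functionals \<open>\<^sup>*C\<^sup>*\<close>, without the normalisation off the carrier.\<close>

abbreviation dual where "dual \<equiv> bimod_hom A C (regular_bimod A)"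

lemma dualD:
  assumes "f \<in> dual"
  shows "\<And>x. x \<in> carrier C \<Longrightarrow> f x \<in> carrier A"
    and "\<And>x y. \<lbrakk>x \<in> carrier C; y \<in> carrier C\<rbrakk> \<Longrightarrow> f (x \<oplus>\<^bsub>C\<^esub> y) = f x \<oplus>\<^bsub>A\<^esub> f y"
    and "\<And>a x. \<lbrakk>a \<in> carrier A; x \<in> carrier C\<rbrakk> \<Longrightarrow> f (lact C a x) = a \<otimes>\<^bsub>A\<^esub> f x"
    and "\<And>a x. \<lbrakk>a \<in> carrier A; x \<in> carrier C\<rbrakk> \<Longrightarrow> f (ract C x a) = f x \<otimes>\<^bsub>A\<^esub> a"
  using bimod_homD(4-7) [OF assms] by (simp_all add: regular_bimod_def)

text \<open>Both harpoons are a contraction of \<open>C \<otimes> C\<close> composed with the comultiplication, so their properties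
  split into those of the contraction, checked on pure tensors, and those of the comultiplication.\<close>

abbreviation contract_left where "contract_left f \<equiv> tensor_sum C (\<lambda>x y. lact C (f x) y)"
abbreviation contract_right where "contract_right f \<equiv> tensor_sum C (\<lambda>x y. ract C x (f y))"

lemma contract_left_balanced: "f \<in> dual \<Longrightarrow> balanced A C C C (\<lambda>x y. lact C (f x) y)"
  by (rule balancedI) (simp_all add: dualD lact_closed lact_add lact_add_scalar lact_mult)

lemma contract_right_balanced: "f \<in> dual \<Longrightarrow> balanced A C C C (\<lambda>x y. ract C x (f y))"
  by (rule balancedI) (simp_all add: dualD ract_closed ract_add ract_add_scalar ract_mult)

lemmas contract_left_additive = CCC.MN.TF.tensor_sum_additive [OF C_abelian contract_left_balanced]
lemmas contract_left_tens = CCC.MN.TF.tensor_sum_tens [OF C_abelian contract_left_balanced]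
lemmas contract_right_additive = CCC.MN.TF.tensor_sum_additive [OF C_abelian contract_right_balanced]
lemmas contract_right_tens = CCC.MN.TF.tensor_sum_tens [OF C_abelian contract_right_balanced]

lemma contract_left_hom:
  assumes f: "f \<in> dual"
  shows "contract_left f \<in> bimod_hom A CC C"
proof (rule bimod_homI)
  note ad = contract_left_additive [OF f]
  note [simp] = additive_closed [OF ad] additive_add [OF ad] contract_left_tens [OF f]
    CCC.MN.lact_tens CCC.MN.ract_tens lact_closed ract_closed dualD [OF f] lact_mult lact_ract lact_add ract_add
    additive_add [OF CCC.MN.lact_additive] additive_add [OF CCC.MN.ract_additive]
    additive_closed [OF CCC.MN.lact_additive] additive_closed [OF CCC.MN.ract_additive]
  show "contract_left f \<in> additive CC C" using ad by (simp add: additive_def)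
  fix a u assume a: "a \<in> carrier A" and "u \<in> carrier CC"
  then have u: "u \<in> carrier TC" by simp
  from u show "contract_left f (lact CC a u) = lact C a (contract_left f u)"
    by (induction u rule: CCC.MN.TF.tensor_induct) (use a in simp_all)
  from u show "contract_left f (ract CC u a) = ract C (contract_left f u) a"
    by (induction u rule: CCC.MN.TF.tensor_induct) (use a in simp_all)
qed

lemma contract_right_hom:
  assumes f: "f \<in> dual"
  shows "contract_right f \<in> bimod_hom A CC C"
proof (rule bimod_homI)
  note ad = contract_right_additive [OF f]
  note [simp] = additive_closed [OF ad] additive_add [OF ad] contract_right_tens [OF f]
    CCC.MN.lact_tens CCC.MN.ract_tens lact_closed ract_closed dualD [OF f] ract_mult lact_ract lact_add ract_add
    additive_add [OF CCC.MN.lact_additive] additive_add [OF CCC.MN.ract_additive]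
    additive_closed [OF CCC.MN.lact_additive] additive_closed [OF CCC.MN.ract_additive]
  show "contract_right f \<in> additive CC C" using ad by (simp add: additive_def)
  fix a u assume a: "a \<in> carrier A" and "u \<in> carrier CC"
  then have u: "u \<in> carrier TC" by simp
  from u show "contract_right f (lact CC a u) = lact C a (contract_right f u)"
    by (induction u rule: CCC.MN.TF.tensor_induct) (use a in simp_all)
  from u show "contract_right f (ract CC u a) = ract C (contract_right f u) a"
    by (induction u rule: CCC.MN.TF.tensor_induct) (use a in simp_all)
qed

lemma lharpoon_eq: "lharpoon C c f = contract_left f (comult C c)"
  by (simp add: lharpoon_def)

lemma rharpoon_eq: "rharpoon C f c = contract_right f (comult C c)"
  by (simp add: rharpoon_def)

lemma lharpoon_hom: "f \<in> dual \<Longrightarrow> (\<lambda>c. lharpoon C c f) \<in> bimod_hom A C C"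
  unfolding lharpoon_eq by (rule bimod_hom_comp [OF comult_hom contract_left_hom])

lemma rharpoon_hom: "f \<in> dual \<Longrightarrow> (\<lambda>c. rharpoon C f c) \<in> bimod_hom A C C"
  unfolding rharpoon_eq by (rule bimod_hom_comp [OF comult_hom contract_right_hom])

lemma coring_tensor_factors: "tensor_factors A C C" "tensor_factors A CC C" "tensor_factors A C CC"
  by (rule CCC.MN.TF.tensor_factors_axioms CCC.MN_P.TF.tensor_factors_axioms
        CCC.M_NP.TF.tensor_factors_axioms)+

text \<open>\<open>\<Delta>(\<Sum> f(c\<^sub>1) c\<^sub>2) = \<Sum> f(c\<^sub>1) c\<^sub>2 \<otimes> c\<^sub>3 = \<Sum> (c\<^sub>1 \<leftharpoonup> f) \<otimes> c\<^sub>2\<close>: since \<open>\<Delta>\<close> is left linear, the scalar \<open>f(c\<^sub>1)\<close> comes out, and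
  coassociativity allows the threefold tensor to be bracketed so that \<open>f\<close> contracts within the first
  comultiplication. The map \<open>H\<close> in the proof contracts the first of three factors.\<close>

lemma comult_lharpoon:
  assumes f: "f \<in> dual" and c: "c \<in> carrier C"
  shows "comult C (lharpoon C c f) = tensor_map A C C (\<lambda>c. lharpoon C c f) id (comult C c)"
proof -
  let ?F = "contract_left f"
  \<comment> \<open>\<open>H(x \<otimes> u) = f(x) u\<close>\<close>
  let ?H = "tensor_sum TC (\<lambda>x u. lact CC (f x) u)"
  let ?\<Delta> = "comult C"
  note F = contract_left_hom [OF f]
  note D = bimod_homD [OF comult_hom]
  note I = bimod_homD [OF bimod_hom_id(2)]
  have Hbal: "balanced A C CC TC (\<lambda>x u. lact CC (f x) u)"
    by (rule balancedI)
       (simp_all add: dualD [OF f] CCC.MN_P.M.lact_closed [simplified] CCC.MN_P.M.lact_add [simplified]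
         CCC.MN_P.M.lact_add_scalar [simplified] CCC.MN_P.M.lact_mult [simplified])
  note H = CCC.M_NP.TF.tensor_sum_additive [OF CCC.MN.TF.tensor_group_abelian Hbal]
  note H_tens = CCC.M_NP.TF.tensor_sum_tens [OF CCC.MN.TF.tensor_group_abelian Hbal, simplified]
  note idD = tensor_map_additive [OF coring_tensor_factors(1,3) I(2) D(1)]
  note idD_tens = tensor_map_tens [OF coring_tensor_factors(1,3) I(2) D(1)]
  note Did = tensor_map_additive [OF coring_tensor_factors(1,2) D(2) I(1)]
  note Did_tens = tensor_map_tens [OF coring_tensor_factors(1,2) D(2) I(1)]
  note Fid = tensor_map_additive [OF coring_tensor_factors(2,1) bimod_homD(2) [OF F] I(1)]
  note Fid_tens = tensor_map_tens [OF coring_tensor_factors(2,1) bimod_homD(2) [OF F] I(1)]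
  have hom: "(\<lambda>c. ?F (?\<Delta> c)) \<in> bimod_hom A C C" by (rule bimod_hom_comp [OF comult_hom F])
  note FD = tensor_map_additive [OF coring_tensor_factors(1,1) bimod_homD(2) [OF hom] I(1)]
  note FD_tens = tensor_map_tens [OF coring_tensor_factors(1,1) bimod_homD(2) [OF hom] I(1)]
  have u: "?\<Delta> c \<in> carrier TC" using c comult_simps by simp
  have DF: "(\<lambda>u. ?\<Delta> (?F u)) \<in> additive TC TC"
    using additive_comp [OF contract_left_additive [OF f] D(3)] by (simp add: additive_def)
  \<comment> \<open>left linearity of the comultiplication\<close>
  have "?\<Delta> (?F u) = ?H (tensor_map A C CC id ?\<Delta> u)" if "u \<in> carrier TC" for u
    using CCC.MN.TF.tensor_ext [OF DF additive_comp [OF idD H] _ that]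
    by (simp add: contract_left_tens [OF f] idD_tens H_tens comult_simps dualD [OF f])
  \<comment> \<open>Both sides send \<open>(x \<otimes> y) \<otimes> z\<close> to \<open>f(x) y \<otimes> z\<close>.\<close>
  moreover have "?H (tensor_assoc A C C C w) = tensor_map A C C ?F id w"
    if "w \<in> carrier (tensor_group A CC C)" for w
  proof (rule CCC.MN_P.TF.tensor_ext [OF additive_comp [OF CCC.tensor_assoc_additive H] Fid _ that])
    fix u z assume "u \<in> carrier CC" and z: "z \<in> carrier C"
    then have u: "u \<in> carrier TC" by simp
    have add: "(\<lambda>u. tens A C C (?F u) z) \<in> additive TC TC"
      using z by (simp add: additive_def CCC.MN.TF.tens_closed CCC.MN.TF.tens_add_left
        additive_closed [OF contract_left_additive [OF f]] additive_add [OF contract_left_additive [OF f]])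
    have "?H (CCC.assoc_at z u) = tens A C C (?F u) z"
      by (rule CCC.MN.TF.tensor_ext [OF additive_comp [OF CCC.assoc_at_additive [OF z] H] add _ u])
         (simp add: CCC.assoc_at_tens z H_tens CCC.MN.TF.tens_closed contract_left_tens [OF f]
           CCC.MN.lact_tens dualD [OF f])
    then show "?H (tensor_assoc A C C C (tens A CC C u z)) = tensor_map A C C ?F id (tens A CC C u z)"
      using u z by (simp add: CCC.tensor_assoc_tens Fid_tens)
  qed
  moreover have "tensor_map A C C ?F id (tensor_map A CC C ?\<Delta> id u)
      = tensor_map A C C (\<lambda>c. ?F (?\<Delta> c)) id u" if "u \<in> carrier TC" for u
    using CCC.MN.TF.tensor_ext [OF additive_comp [OF Did Fid] FD _ that]
    by (simp add: Did_tens Fid_tens FD_tens comult_simps)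
  ultimately show ?thesis
    using u coassoc [OF c, symmetric] additive_closed [OF Did u] by (simp add: lharpoon_eq)
qed

text \<open>The mirror image, \<open>\<Delta>(\<Sum> c\<^sub>1 f(c\<^sub>2)) = \<Sum> c\<^sub>1 \<otimes> c\<^sub>2 f(c\<^sub>3)\<close>, now by right linearity of \<open>\<Delta>\<close>; here \<open>H\<close> contracts the
  last of three factors.\<close>

lemma comult_rharpoon:
  assumes f: "f \<in> dual" and c: "c \<in> carrier C"
  shows "comult C (rharpoon C f c) = tensor_map A C C id (rharpoon C f) (comult C c)"
proof -
  let ?F = "contract_right f"
  let ?H = "tensor_sum TC (\<lambda>u z. ract CC u (f z))"
  let ?\<Delta> = "comult C"
  note F = contract_right_hom [OF f]
  note D = bimod_homD [OF comult_hom]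
  note I = bimod_homD [OF bimod_hom_id(2)]
  have Hbal: "balanced A CC C TC (\<lambda>u z. ract CC u (f z))"
    by (rule balancedI)
       (simp_all add: dualD [OF f] CCC.MN_P.M.ract_closed [simplified] CCC.MN_P.M.ract_add [simplified]
         CCC.MN_P.M.ract_add_scalar [simplified] CCC.MN_P.M.ract_mult [simplified])
  note H = CCC.MN_P.TF.tensor_sum_additive [OF CCC.MN.TF.tensor_group_abelian Hbal]
  note H_tens = CCC.MN_P.TF.tensor_sum_tens [OF CCC.MN.TF.tensor_group_abelian Hbal, simplified]
  note idD = tensor_map_additive [OF coring_tensor_factors(1,3) I(2) D(1)]
  note idD_tens = tensor_map_tens [OF coring_tensor_factors(1,3) I(2) D(1)]
  note Did = tensor_map_additive [OF coring_tensor_factors(1,2) D(2) I(1)]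
  note Did_tens = tensor_map_tens [OF coring_tensor_factors(1,2) D(2) I(1)]
  note idF = tensor_map_additive [OF coring_tensor_factors(3,1) I(2) bimod_homD(1) [OF F]]
  note idF_tens = tensor_map_tens [OF coring_tensor_factors(3,1) I(2) bimod_homD(1) [OF F]]
  have hom: "(\<lambda>c. ?F (?\<Delta> c)) \<in> bimod_hom A C C" by (rule bimod_hom_comp [OF comult_hom F])
  note FD = tensor_map_additive [OF coring_tensor_factors(1,1) I(2) bimod_homD(1) [OF hom]]
  note FD_tens = tensor_map_tens [OF coring_tensor_factors(1,1) I(2) bimod_homD(1) [OF hom]]
  have u: "?\<Delta> c \<in> carrier TC" using c comult_simps by simp
  have DF: "(\<lambda>u. ?\<Delta> (?F u)) \<in> additive TC TC"
    using additive_comp [OF contract_right_additive [OF f] D(3)] by (simp add: additive_def)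
  have "?\<Delta> (?F u) = ?H (tensor_map A CC C ?\<Delta> id u)" if "u \<in> carrier TC" for u
    using CCC.MN.TF.tensor_ext [OF DF additive_comp [OF Did H] _ that]
    by (simp add: contract_right_tens [OF f] Did_tens H_tens comult_simps dualD [OF f])
  moreover have "?H w = tensor_map A C C id ?F (tensor_assoc A C C C w)"
    if "w \<in> carrier (tensor_group A CC C)" for w
  proof (rule CCC.MN_P.TF.tensor_ext [OF H additive_comp [OF CCC.tensor_assoc_additive idF] _ that])
    fix u z assume "u \<in> carrier CC" and z: "z \<in> carrier C"
    then have u: "u \<in> carrier TC" by simp
    have "ract CC u (f z) = tensor_map A C C id ?F (CCC.assoc_at z u)"
      by (rule CCC.MN.TF.tensor_ext [OF CCC.MN.ract_additive [OF dualD(1) [OF f z]]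
            additive_comp [OF CCC.assoc_at_additive [OF z] idF] _ u])
         (simp add: CCC.assoc_at_tens z idF_tens CCC.MN.TF.tens_closed contract_right_tens [OF f]
           CCC.MN.ract_tens dualD [OF f])
    then show "?H (tens A CC C u z) = tensor_map A C C id ?F (tensor_assoc A C C C (tens A CC C u z))"
      using u z by (simp add: CCC.tensor_assoc_tens H_tens)
  qed
  moreover have "tensor_map A C C id ?F (tensor_map A C CC id ?\<Delta> u)
      = tensor_map A C C id (\<lambda>c. ?F (?\<Delta> c)) u" if "u \<in> carrier TC" for u
    using CCC.MN.TF.tensor_ext [OF additive_comp [OF idD idF] FD _ that]
    by (simp add: idD_tens idF_tens FD_tens comult_simps)
  ultimately show ?thesis
    using u coassoc [OF c] additive_closed [OF Did u] by (simp add: rharpoon_eq [abs_def])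
qed

end

section \<open>Bicolinear endomorphisms of a coring\<close>

text \<open>Regarding \<open>C\<close> as a bicomodule over itself changes the type of the record but none of the fields
  from which tensor products, tensor maps and associators are built.\<close>

lemma self_bicomod_simps [simp]:
  "carrier (self_bicomod C) = carrier C" "add (self_bicomod C) = add C" "zero (self_bicomod C) = zero C"
  "lact (self_bicomod C) = lact C" "ract (self_bicomod C) = ract C"
  "rcoact (self_bicomod C) = comult C" "lcoact (self_bicomod C) = comult C"
  by (simp_all add: self_bicomod_def)

lemma bimod_hom_self [simp]:
  "bimod_hom A (self_bicomod C) N = bimod_hom A C N" "bimod_hom A N (self_bicomod C) = bimod_hom A N C"
  by (simp_all add: bimod_hom_def left_hom_def right_hom_def)

lemma tensor_self [simp]:
  "tensor_group A (self_bicomod C) N = tensor_group A C N"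
  "tensor_group A N (self_bicomod C) = tensor_group A N C"
  "tens A (self_bicomod C) N = tens A C N"
  "tens A N (self_bicomod C) = tens A N C"
  "tensor_bimod A (self_bicomod C) N = tensor_bimod A C N"
  "tensor_bimod A N (self_bicomod C) = tensor_bimod A N C"
  "tensor_map A (self_bicomod C) N = tensor_map A C N"
  "tensor_map A N (self_bicomod C) = tensor_map A N C"
  "tensor_assoc A (self_bicomod C) N P = tensor_assoc A C N P"
  "tensor_assoc A N (self_bicomod C) P = tensor_assoc A N C P"
  "tensor_assoc A N P (self_bicomod C) = tensor_assoc A N P C"
  by (simp_all add: fun_eq_iff tensor_bimod_def tensor_map_def tensor_assoc_def tensor_group_def
      tens_def tensor_rel_def tensor_free_def)

lemma tensor_sum_self: "tensor_sum (self_bicomod C) = tensor_sum C"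
  by (intro ext) (simp add: tensor_sum_def finsum_def finprod_def add_pow_def int_pow_def nat_pow_def m_inv_def Let_def
      cong: if_cong)

context A_coring
begin

abbreviation tm where "tm \<equiv> tensor_map A C C"

lemma bimod_hom_cong:
  assumes "f \<in> bimod_hom A C N" "\<And>x. x \<in> carrier C \<Longrightarrow> k x = f x"
  shows "k \<in> bimod_hom A C N"
  by (rule bimod_homI)
     (use assms in \<open>auto simp: additive_def bimod_homD [OF assms(1)] lact_closed ract_closed\<close>)

lemma tm_additive: "\<lbrakk>f \<in> bimod_hom A C C; g \<in> bimod_hom A C C\<rbrakk> \<Longrightarrow> tm f g \<in> additive TC TC"
  by (rule tensor_map_additive [OF coring_tensor_factors(1,1)]) (auto dest: bimod_homD)

lemma tm_tens:
  "\<lbrakk>f \<in> bimod_hom A C C; g \<in> bimod_hom A C C; x \<in> carrier C; y \<in> carrier C\<rbrakk> \<Longrightarrow>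
    tm f g (tens A C C x y) = tens A C C (f x) (g y)"
  by (rule tensor_map_tens [OF coring_tensor_factors(1,1)]) (auto dest: bimod_homD)

text \<open>The composites are variables \<open>k\<close> and \<open>l\<close> that need only agree on \<open>C\<close>, since a composite with the
  identity is rarely wanted in the literal form \<open>g \<circ> id\<close>.\<close>

lemma tm_comp:
  assumes h: "f \<in> bimod_hom A C C" "g \<in> bimod_hom A C C" "f' \<in> bimod_hom A C C" "g' \<in> bimod_hom A C C"
    and k: "\<And>x. x \<in> carrier C \<Longrightarrow> k x = f (f' x)" and l: "\<And>x. x \<in> carrier C \<Longrightarrow> l x = g (g' x)"
    and u: "u \<in> carrier TC"
  shows "tm f g (tm f' g' u) = tm k l u"
proof -
  have kl: "k \<in> bimod_hom A C C" "l \<in> bimod_hom A C C"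
    using bimod_hom_cong [OF bimod_hom_comp [OF h(3,1)], of k]
      bimod_hom_cong [OF bimod_hom_comp [OF h(4,2)], of l] k l by blast+
  show ?thesis
    by (rule CCC.MN.TF.tensor_ext [OF additive_comp [OF tm_additive [OF h(3,4)] tm_additive [OF h(1,2)]]
          tm_additive [OF kl] _ u])
       (simp add: tm_tens h kl k l bimod_homD [OF h(3)] bimod_homD [OF h(4)])
qed

lemma tm_cong:
  assumes "f \<in> bimod_hom A C C" "g \<in> bimod_hom A C C"
    and "\<And>x. x \<in> carrier C \<Longrightarrow> k x = f x" and "\<And>x. x \<in> carrier C \<Longrightarrow> l x = g x"
    and "u \<in> carrier TC"
  shows "tm f g u = tm k l u"
proof -
  have kl: "k \<in> bimod_hom A C C" "l \<in> bimod_hom A C C"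
    using bimod_hom_cong [OF assms(1), of k] bimod_hom_cong [OF assms(2), of l] assms(3,4) by blast+
  show ?thesis
    by (rule CCC.MN.TF.tensor_ext [OF tm_additive [OF assms(1,2)] tm_additive [OF kl] _ assms(5)])
       (simp add: tm_tens kl assms)
qed

lemma comult_closed: "c \<in> carrier C \<Longrightarrow> comult C c \<in> carrier TC"
  by (rule comult_simps(4))

abbreviation endos where "endos \<equiv> bicolinear A C (self_bicomod C) (self_bicomod C)"

lemma endos_iff:
  "g \<in> endos \<longleftrightarrow> g \<in> bimod_hom A C C \<and>
    (\<forall>c \<in> carrier C. comult C (g c) = tm g id (comult C c)) \<and>
    (\<forall>c \<in> carrier C. comult C (g c) = tm id g (comult C c))"
  by (simp add: bicolinear_def)

lemma endosI:
  assumes "g \<in> bimod_hom A C C"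
    and "\<And>c. c \<in> carrier C \<Longrightarrow> comult C (g c) = tm g id (comult C c)"
    and "\<And>c. c \<in> carrier C \<Longrightarrow> comult C (g c) = tm id g (comult C c)"
  shows "g \<in> endos"
  using assms by (simp add: endos_iff)

lemma endosD:
  assumes "g \<in> endos"
  shows "g \<in> bimod_hom A C C"
    and "\<And>c. c \<in> carrier C \<Longrightarrow> comult C (g c) = tm g id (comult C c)"
    and "\<And>c. c \<in> carrier C \<Longrightarrow> comult C (g c) = tm id g (comult C c)"
    and "\<And>c. c \<in> carrier C \<Longrightarrow> g c \<in> carrier C"
    and "\<And>x y. \<lbrakk>x \<in> carrier C; y \<in> carrier C\<rbrakk> \<Longrightarrow> g (x \<oplus>\<^bsub>C\<^esub> y) = g x \<oplus>\<^bsub>C\<^esub> g y"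
    and "\<And>a x. \<lbrakk>a \<in> carrier A; x \<in> carrier C\<rbrakk> \<Longrightarrow> g (lact C a x) = lact C a (g x)"
    and "\<And>a x. \<lbrakk>a \<in> carrier A; x \<in> carrier C\<rbrakk> \<Longrightarrow> g (ract C x a) = ract C (g x) a"
proof -
  show g: "g \<in> bimod_hom A C C" using assms by (simp add: endos_iff)
  show "comult C (g c) = tm g id (comult C c)" "comult C (g c) = tm id g (comult C c)"
    if "c \<in> carrier C" for c
    using assms that unfolding endos_iff by blast+
qed (use bimod_homD [of g A C C] assms in \<open>simp_all add: endos_iff\<close>)

text \<open>Colinearity only depends on the values on \<open>C\<close>. This is what permits passing between a function and
  its restriction that is \<open>undefined\<close> off the carrier.\<close>

lemma endos_cong:
  assumes g: "g \<in> endos" and k: "\<And>x. x \<in> carrier C \<Longrightarrow> k x = g x"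
  shows "k \<in> endos"
proof (rule endosI)
  note G = endosD [OF g]
  show "k \<in> bimod_hom A C C" by (rule bimod_hom_cong [OF G(1) k])
  fix c assume c: "c \<in> carrier C"
  show "comult C (k c) = tm k id (comult C c)" "comult C (k c) = tm id k (comult C c)"
    using tm_cong [OF G(1) bimod_hom_id(2), of k id] tm_cong [OF bimod_hom_id(2) G(1), of id k]
      c k comult_closed G(2,3) by simp_all
qed

lemma id_endos: "(\<lambda>c. c) \<in> endos"
proof (rule endosI [OF bimod_hom_id(1)])
  fix c assume c: "c \<in> carrier C"
  have "tm (\<lambda>c. c) id u = u" if "u \<in> carrier TC" for u
    by (rule CCC.MN.TF.tensor_ext [OF tm_additive [OF bimod_hom_id] additive_id _ that])
       (simp add: tm_tens bimod_hom_id)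
  then show "comult C c = tm (\<lambda>c. c) id (comult C c)" using c comult_closed by simp
  have "tm id (\<lambda>c. c) u = u" if "u \<in> carrier TC" for u
    by (rule CCC.MN.TF.tensor_ext [OF tm_additive [OF bimod_hom_id(2,1)] additive_id _ that])
       (simp add: tm_tens bimod_hom_id)
  then show "comult C c = tm id (\<lambda>c. c) (comult C c)" using c comult_closed by simp
qed

lemma comp_endos:
  assumes g: "g \<in> endos" and h: "h \<in> endos"
  shows "(\<lambda>c. g (h c)) \<in> endos"
proof (rule endosI)
  note G = endosD [OF g] and H = endosD [OF h]
  show "(\<lambda>c. g (h c)) \<in> bimod_hom A C C" by (rule bimod_hom_comp [OF H(1) G(1)])
  fix c assume c: "c \<in> carrier C"
  have "comult C (g (h c)) = tm g id (tm h id (comult C c))" using c G H by simp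
  also have "\<dots> = tm (\<lambda>c. g (h c)) id (comult C c)"
    by (rule tm_comp) (simp_all add: G H bimod_hom_id c comult_closed)
  finally show "comult C (g (h c)) = tm (\<lambda>c. g (h c)) id (comult C c)" .
  have "comult C (g (h c)) = tm id g (tm id h (comult C c))" using c G(3) H(3,4) by simp
  also have "\<dots> = tm id (\<lambda>c. g (h c)) (comult C c)"
    by (rule tm_comp) (simp_all add: G H bimod_hom_id c comult_closed)
  finally show "comult C (g (h c)) = tm id (\<lambda>c. g (h c)) (comult C c)" .
qed

text \<open>Right colinearity of \<open>g\<close> lets \<open>g\<close> act on the first factor only, left colinearity of \<open>h\<close> lets \<open>h\<close> act
  on the second factor only. The two operations do not interfere, whichever is performed first.\<close>

lemma comult_comp:
  assumes g: "g \<in> endos" and h: "h \<in> endos" and c: "c \<in> carrier C"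
  shows "comult C (g (h c)) = tm g h (comult C c)" "comult C (h (g c)) = tm g h (comult C c)"
proof -
  note G = endosD [OF g] and H = endosD [OF h]
  have "comult C (g (h c)) = tm g id (tm id h (comult C c))" using c G(2) H(3,4) by simp
  also have "\<dots> = tm g h (comult C c)"
    by (rule tm_comp) (simp_all add: G H bimod_hom_id c comult_closed)
  finally show "comult C (g (h c)) = tm g h (comult C c)" .
  have "comult C (h (g c)) = tm id h (tm g id (comult C c))" using c G(2,4) H(3) by simp
  also have "\<dots> = tm g h (comult C c)"
    by (rule tm_comp) (simp_all add: G H bimod_hom_id c comult_closed)
  finally show "comult C (h (g c)) = tm g h (comult C c)" .
qed

text \<open>Both composites have the same comultiplication, and the comultiplication is injective because the
  counit provides a left inverse.\<close>

lemma endos_commute: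
  assumes g: "g \<in> endos" and h: "h \<in> endos" and c: "c \<in> carrier C"
  shows "g (h c) = h (g c)"
proof -
  have "g (h c) = contract_right (counit C) (comult C (g (h c)))"
    using counit_right [of "g (h c)"] endosD(4) [OF g] endosD(4) [OF h] c by simp
  also have "\<dots> = contract_right (counit C) (comult C (h (g c)))"
    by (simp add: comult_comp [OF g h c])
  also have "\<dots> = h (g c)"
    using counit_right [of "h (g c)"] endosD(4) [OF g] endosD(4) [OF h] c by simp
  finally show ?thesis .
qed

lemma add_endos:
  assumes g: "g \<in> endos" and h: "h \<in> endos"
  shows "(\<lambda>c. g c \<oplus>\<^bsub>C\<^esub> h c) \<in> endos" (is "?k \<in> _")
proof (rule endosI)
  note G = endosD [OF g] and H = endosD [OF h] and I = bimod_hom_id(2)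
  show k: "?k \<in> bimod_hom A C C"
    by (rule bimod_homI) (simp_all add: additive_def G H C_ac C_closed lact_add ract_add lact_closed ract_closed)
  note ad = additive_sum [OF CCC.MN.TF.tensor_group_abelian]
  fix c assume c: "c \<in> carrier C"
  have "tm ?k id u = tm g id u \<oplus>\<^bsub>TC\<^esub> tm h id u" if "u \<in> carrier TC" for u
    by (rule CCC.MN.TF.tensor_ext [OF tm_additive [OF k I] ad [OF tm_additive [OF G(1) I]
          tm_additive [OF H(1) I]] _ that])
       (simp add: tm_tens k I G H CCC.MN.TF.tens_add_left)
  then show "comult C (?k c) = tm ?k id (comult C c)"
    using c G(2,4) H(2,4) comult_closed by (simp add: comult_simps)
  have "tm id ?k u = tm id g u \<oplus>\<^bsub>TC\<^esub> tm id h u" if "u \<in> carrier TC" for u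
    by (rule CCC.MN.TF.tensor_ext [OF tm_additive [OF I k] ad [OF tm_additive [OF I G(1)]
          tm_additive [OF I H(1)]] _ that])
       (simp add: tm_tens k I G H CCC.MN.TF.tens_add_right)
  then show "comult C (?k c) = tm id ?k (comult C c)"
    using c G(3,4) H(3,4) comult_closed by (simp add: comult_simps)
qed

lemmas A_monoid = ringE(2) [OF A_ring]

lemma unit_scalar:
  assumes "r \<in> carrier R"
  shows "r \<odot>\<^bsub>A\<^esub> \<one>\<^bsub>A\<^esub> \<in> carrier A"
    and "a \<in> carrier A \<Longrightarrow> (r \<odot>\<^bsub>A\<^esub> \<one>\<^bsub>A\<^esub>) \<otimes>\<^bsub>A\<^esub> a = r \<odot>\<^bsub>A\<^esub> a"
    and "a \<in> carrier A \<Longrightarrow> a \<otimes>\<^bsub>A\<^esub> (r \<odot>\<^bsub>A\<^esub> \<one>\<^bsub>A\<^esub>) = r \<odot>\<^bsub>A\<^esub> a"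
proof -
  show "r \<odot>\<^bsub>A\<^esub> \<one>\<^bsub>A\<^esub> \<in> carrier A" using assms by (simp add: smult_closed monoid.one_closed [OF A_monoid])
  show "a \<in> carrier A \<Longrightarrow> (r \<odot>\<^bsub>A\<^esub> \<one>\<^bsub>A\<^esub>) \<otimes>\<^bsub>A\<^esub> a = r \<odot>\<^bsub>A\<^esub> a"
    using assms smult_mult_left [of r "\<one>\<^bsub>A\<^esub>" a] monoid.l_one [OF A_monoid] monoid.one_closed [OF A_monoid] by simp
  show "a \<in> carrier A \<Longrightarrow> a \<otimes>\<^bsub>A\<^esub> (r \<odot>\<^bsub>A\<^esub> \<one>\<^bsub>A\<^esub>) = r \<odot>\<^bsub>A\<^esub> a"
    using assms smult_mult_right [of r a "\<one>\<^bsub>A\<^esub>"] monoid.r_one [OF A_monoid] monoid.one_closed [OF A_monoid] by simp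
qed

text \<open>For left colinearity the scalar has to reach the second tensor factor. It gets there because
  \<open>r 1\<^sub>A\<close> acts on \<open>C\<close> from the left as it does from the right, and \<open>\<Delta>\<close> is right linear.\<close>

lemma smult_endos:
  assumes r: "r \<in> carrier R" and g: "g \<in> endos"
  shows "(\<lambda>c. lact C (r \<odot>\<^bsub>A\<^esub> \<one>\<^bsub>A\<^esub>) (g c)) \<in> endos" (is "?k \<in> _")
proof (rule endosI)
  let ?s = "r \<odot>\<^bsub>A\<^esub> \<one>\<^bsub>A\<^esub>"
  note G = endosD [OF g] and I = bimod_hom_id(2) and s = unit_scalar [OF r]
  show k: "?k \<in> bimod_hom A C C"
  proof (rule bimod_homI)
    show "?k \<in> additive C C" using s by (simp add: additive_def G lact_closed lact_add)
    fix a c assume ac: "a \<in> carrier A" "c \<in> carrier C"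
    show "?k (lact C a c) = lact C a (?k c)"
      using ac s(1) by (simp add: G lact_mult [symmetric] s(2,3))
    show "?k (ract C c a) = ract C (?k c) a"
      using ac s(1) by (simp add: G lact_ract)
  qed
  fix c assume c: "c \<in> carrier C"
  have "tm ?k id u = lact CC ?s (tm g id u)" if "u \<in> carrier TC" for u
    by (rule CCC.MN.TF.tensor_ext [OF tm_additive [OF k I] additive_comp [OF tm_additive [OF G(1) I]
          CCC.MN.lact_additive [OF s(1)]] _ that])
       (simp add: tm_tens k I G s CCC.MN.lact_tens)
  then show "comult C (?k c) = tm ?k id (comult C c)"
    using c G(2,4) comult_closed s(1) by (simp add: comult_simps)
  have "tm id ?k u = ract CC (tm id g u) ?s" if "u \<in> carrier TC" for u
    by (rule CCC.MN.TF.tensor_ext [OF tm_additive [OF I k] additive_comp [OF tm_additive [OF I G(1)]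
          CCC.MN.ract_additive [OF s(1)]] _ that])
       (simp add: tm_tens k I G s CCC.MN.ract_tens central r)
  then show "comult C (?k c) = tm id ?k (comult C c)"
    using c G(3,4) comult_closed s(1) by (simp add: central r comult_simps)
qed

text \<open>The description \<open>c \<leftharpoonup> f\<close> gives right colinearity and \<open>f \<rightharpoonup> c\<close> gives left colinearity; a functional in the
  centralizer has both descriptions at once.\<close>

lemma harpoon_endos:
  assumes f: "f \<in> dual" and eq: "\<And>c. c \<in> carrier C \<Longrightarrow> rharpoon C f c = lharpoon C c f"
  shows "(\<lambda>c. rharpoon C f c) \<in> endos"
proof (rule endosI [OF rharpoon_hom [OF f]])
  fix c assume c: "c \<in> carrier C"
  show "comult C (rharpoon C f c) = tm id (\<lambda>c. rharpoon C f c) (comult C c)"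
    by (rule comult_rharpoon [OF f c])
  have "comult C (rharpoon C f c) = tm (\<lambda>c. lharpoon C c f) id (comult C c)"
    using comult_lharpoon [OF f c] eq [OF c] by simp
  also have "\<dots> = tm (\<lambda>c. rharpoon C f c) id (comult C c)"
    by (rule tm_cong [OF lharpoon_hom [OF f] bimod_hom_id(2)]) (simp_all add: eq c comult_closed)
  finally show "comult C (rharpoon C f c) = tm (\<lambda>c. rharpoon C f c) id (comult C c)" .
qed

text \<open>\<open>\<Sum> c\<^sub>1 \<epsilon>(g(c\<^sub>2))\<close> is the contraction of \<open>(id \<otimes> g)(\<Delta> c) = \<Delta>(g c)\<close> with the counit, hence \<open>g c\<close>; likewise on
  the other side. The functional is a variable \<open>h\<close> that agrees with \<open>\<epsilon> \<circ> g\<close> on \<open>C\<close>, so that both the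
  composite itself and its restriction \<open>psi C g\<close> are covered.\<close>

lemma counit_endo:
  assumes g: "g \<in> endos" and h: "\<And>c. c \<in> carrier C \<Longrightarrow> h c = counit C (g c)"
  shows "h \<in> dual"
    and "c \<in> carrier C \<Longrightarrow> rharpoon C h c = g c"
    and "c \<in> carrier C \<Longrightarrow> lharpoon C c h = g c"
proof -
  note G = endosD [OF g] and I = bimod_hom_id(2)
  show hd: "h \<in> dual"
    using h by (auto intro: bimod_hom_cong [OF bimod_hom_comp [OF G(1) counit_hom]])
  show "rharpoon C h c = g c" if c: "c \<in> carrier C"
  proof -
    have "contract_right h u = contract_right (counit C) (tm id g u)" if "u \<in> carrier TC" for u
      by (rule CCC.MN.TF.tensor_ext [OF contract_right_additive [OF hd] additive_comp
            [OF tm_additive [OF I G(1)] contract_right_additive [OF counit_hom]] _ that])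
         (simp add: contract_right_tens [OF hd] contract_right_tens [OF counit_hom] tm_tens G I h)
    then show ?thesis
      using c counit_right [of "g c"] G(3,4) comult_closed by (simp add: rharpoon_eq)
  qed
  show "lharpoon C c h = g c" if c: "c \<in> carrier C"
  proof -
    have "contract_left h u = contract_left (counit C) (tm g id u)" if "u \<in> carrier TC" for u
      by (rule CCC.MN.TF.tensor_ext [OF contract_left_additive [OF hd] additive_comp
            [OF tm_additive [OF G(1) I] contract_left_additive [OF counit_hom]] _ that])
         (simp add: contract_left_tens [OF hd] contract_left_tens [OF counit_hom] tm_tens G I h)
    then show ?thesis
      using c counit_left [of "g c"] G(2,4) comult_closed by (simp add: lharpoon_eq)
  qed
qed

lemma A_abelian: "abelian_group A"
  by (rule ringE(1) [OF A_ring])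

lemma counit_additive: "counit C \<in> additive C A"
  using dualD [OF counit_hom] by (simp add: additive_def)

text \<open>\<open>\<epsilon>(\<Sum> c\<^sub>1 f(c\<^sub>2)) = \<Sum> \<epsilon>(c\<^sub>1) f(c\<^sub>2) = f(\<Sum> \<epsilon>(c\<^sub>1) c\<^sub>2) = f(c)\<close>.\<close>

lemma counit_rharpoon:
  assumes f: "f \<in> dual" and c: "c \<in> carrier C"
  shows "counit C (rharpoon C f c) = f c"
proof -
  have fA: "f \<in> additive C A" using dualD [OF f] by (simp add: additive_def)
  have "counit C (contract_right f u) = f (contract_left (counit C) u)" if "u \<in> carrier TC" for u
    by (rule CCC.MN.TF.tensor_ext [OF additive_comp [OF contract_right_additive [OF f] counit_additive]
          additive_comp [OF contract_left_additive [OF counit_hom] fA] _ that])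
       (simp add: contract_right_tens [OF f] contract_left_tens [OF counit_hom] dualD [OF f] dualD [OF counit_hom])
  then show ?thesis using counit_left [OF c] c comult_closed by (simp add: rharpoon_eq)
qed

text \<open>\<open>\<Sum> \<epsilon>(g c\<^sub>1) \<epsilon>(h c\<^sub>2)\<close> is \<open>\<epsilon>\<close> of the contraction of \<open>(g \<otimes> h)(\<Delta> c) = \<Delta>(g(h c))\<close> with the counit. This is the
  multiplicativity of \<open>g \<mapsto> \<epsilon> \<circ> g\<close>.\<close>

lemma convolution_counit:
  assumes g: "g \<in> endos" and h: "h \<in> endos"
    and p: "\<And>c. c \<in> carrier C \<Longrightarrow> p c = counit C (g c)"
    and q: "\<And>c. c \<in> carrier C \<Longrightarrow> q c = counit C (h c)"
    and c: "c \<in> carrier C"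
  shows "tensor_sum A (\<lambda>x y. p x \<otimes>\<^bsub>A\<^esub> q y) (comult C c) = counit C (g (h c))"
proof -
  note G = endosD [OF g] and H = endosD [OF h]
  note P = dualD [OF counit_endo(1) [OF g p]] and Q = dualD [OF counit_endo(1) [OF h q]]
  have bal: "balanced A C C A (\<lambda>x y. p x \<otimes>\<^bsub>A\<^esub> q y)"
    by (rule balancedI) (simp_all add: P Q ringE(3,4) [OF A_ring] monoid.m_assoc [OF A_monoid] monoid.m_closed [OF A_monoid])
  have "tensor_sum A (\<lambda>x y. p x \<otimes>\<^bsub>A\<^esub> q y) u = counit C (contract_right (counit C) (tm g h u))"
    if "u \<in> carrier TC" for u
    by (rule CCC.MN.TF.tensor_ext [OF CCC.MN.TF.tensor_sum_additive [OF A_abelian bal] additive_comp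
          [OF additive_comp [OF tm_additive [OF G(1) H(1)] contract_right_additive [OF counit_hom]]
            counit_additive] _ that])
       (simp add: CCC.MN.TF.tensor_sum_tens [OF A_abelian bal] contract_right_tens [OF counit_hom]
          tm_tens G H p q dualD [OF counit_hom])
  then show ?thesis
    using c counit_right [of "g (h c)"] G(4) H(4) comult_closed by (simp add: comult_comp(1) [OF g h c, symmetric])
qed

end

section \<open>The endomorphism algebra\<close>

context A_coring
begin

abbreviation S where "S \<equiv> self_bicomod C"
abbreviation E where "E \<equiv> bicomod_end A C S"

lemma end_simps:
  "carrier E = endos \<inter> extensional (carrier C)"
  "g \<otimes>\<^bsub>E\<^esub> h = (\<lambda>c \<in> carrier C. g (h c))"
  "\<one>\<^bsub>E\<^esub> = (\<lambda>c \<in> carrier C. c)"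
  "\<zero>\<^bsub>E\<^esub> = (\<lambda>c \<in> carrier C. \<zero>\<^bsub>C\<^esub>)"
  "g \<oplus>\<^bsub>E\<^esub> h = (\<lambda>c \<in> carrier C. g c \<oplus>\<^bsub>C\<^esub> h c)"
  "r \<odot>\<^bsub>E\<^esub> g = (\<lambda>c \<in> carrier C. lact C (r \<odot>\<^bsub>A\<^esub> \<one>\<^bsub>A\<^esub>) (g c))"
  by (simp_all add: bicomod_end_def compose_def)

lemma endE:
  assumes "g \<in> carrier E"
  shows "g \<in> endos" "\<And>c. c \<in> carrier C \<Longrightarrow> g c \<in> carrier C"
  using assms endosD(4) [of g] by (auto simp: end_simps)

lemma end_eqI:
  assumes "g \<in> carrier E" "h \<in> carrier E" "\<And>c. c \<in> carrier C \<Longrightarrow> g c = h c"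
  shows "g = h"
  by (rule extensionalityI [of _ "carrier C"]) (use assms in \<open>auto simp: end_simps\<close>)

lemma restrict_endos: "g \<in> endos \<Longrightarrow> (\<lambda>c \<in> carrier C. g c) \<in> carrier E"
  by (auto simp: end_simps intro: endos_cong)

lemma lact_zero: "x \<in> carrier C \<Longrightarrow> lact C \<zero>\<^bsub>A\<^esub> x = \<zero>\<^bsub>C\<^esub>"
  by (rule additive_zero [OF A_abelian C_abelian, of "\<lambda>a. lact C a x"])
     (simp add: additive_def lact_closed lact_add_scalar)

text \<open>Zero and negatives are scalar multiples, so closure under addition, composition and scalars
  is enough.\<close>

lemma zero_smult_end: "\<zero>\<^bsub>E\<^esub> = \<zero>\<^bsub>R\<^esub> \<odot>\<^bsub>E\<^esub> \<one>\<^bsub>E\<^esub>"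
  by (auto simp: end_simps restrict_def fun_eq_iff lact_zero monoid.one_closed [OF A_monoid])

lemma R_cring: "cring R"
  by (rule module.axioms(1) [OF assoc_algebra.axioms(1) [OF assoc_algebra_axioms]])

lemma end_closed:
  "\<one>\<^bsub>E\<^esub> \<in> carrier E" "\<zero>\<^bsub>E\<^esub> \<in> carrier E"
  "\<lbrakk>g \<in> carrier E; h \<in> carrier E\<rbrakk> \<Longrightarrow> g \<otimes>\<^bsub>E\<^esub> h \<in> carrier E"
  "\<lbrakk>g \<in> carrier E; h \<in> carrier E\<rbrakk> \<Longrightarrow> g \<oplus>\<^bsub>E\<^esub> h \<in> carrier E"
  "\<lbrakk>r \<in> carrier R; g \<in> carrier E\<rbrakk> \<Longrightarrow> r \<odot>\<^bsub>E\<^esub> g \<in> carrier E"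
proof -
  interpret R: cring R by (rule R_cring)
  show one: "\<one>\<^bsub>E\<^esub> \<in> carrier E"
    using restrict_endos [OF id_endos] by (simp add: end_simps(3))
  show smult: "r \<odot>\<^bsub>E\<^esub> g \<in> carrier E" if "r \<in> carrier R" "g \<in> carrier E" for r g
    using restrict_endos [OF smult_endos [OF that(1) endE(1) [OF that(2)]]] by (simp add: end_simps(6))
  show "\<zero>\<^bsub>E\<^esub> \<in> carrier E" unfolding zero_smult_end by (rule smult [OF _ one]) simp
  show "\<lbrakk>g \<in> carrier E; h \<in> carrier E\<rbrakk> \<Longrightarrow> g \<otimes>\<^bsub>E\<^esub> h \<in> carrier E"
    using restrict_endos [OF comp_endos, of g h] endE by (simp add: end_simps(2))
  show "\<lbrakk>g \<in> carrier E; h \<in> carrier E\<rbrakk> \<Longrightarrow> g \<oplus>\<^bsub>E\<^esub> h \<in> carrier E"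
    using restrict_endos [OF add_endos, of g h] endE by (simp add: end_simps(5))
qed

lemma end_apply:
  assumes "c \<in> carrier C"
  shows "(g \<otimes>\<^bsub>E\<^esub> h) c = g (h c)" "\<one>\<^bsub>E\<^esub> c = c" "\<zero>\<^bsub>E\<^esub> c = \<zero>\<^bsub>C\<^esub>"
    "(g \<oplus>\<^bsub>E\<^esub> h) c = g c \<oplus>\<^bsub>C\<^esub> h c" "(r \<odot>\<^bsub>E\<^esub> g) c = lact C (r \<odot>\<^bsub>A\<^esub> \<one>\<^bsub>A\<^esub>) (g c)"
  using assms by (simp_all add: end_simps)

lemma scalar_add:
  assumes "r \<in> carrier R" "s \<in> carrier R" "x \<in> carrier C"
  shows "lact C ((r \<oplus>\<^bsub>R\<^esub> s) \<odot>\<^bsub>A\<^esub> \<one>\<^bsub>A\<^esub>) x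
    = lact C (r \<odot>\<^bsub>A\<^esub> \<one>\<^bsub>A\<^esub>) x \<oplus>\<^bsub>C\<^esub> lact C (s \<odot>\<^bsub>A\<^esub> \<one>\<^bsub>A\<^esub>) x"
  using assms by (simp add: smult_l_distr monoid.one_closed [OF A_monoid] lact_add_scalar unit_scalar)

lemma scalar_mult:
  assumes "r \<in> carrier R" "s \<in> carrier R" "x \<in> carrier C"
  shows "lact C ((r \<otimes>\<^bsub>R\<^esub> s) \<odot>\<^bsub>A\<^esub> \<one>\<^bsub>A\<^esub>) x
    = lact C (r \<odot>\<^bsub>A\<^esub> \<one>\<^bsub>A\<^esub>) (lact C (s \<odot>\<^bsub>A\<^esub> \<one>\<^bsub>A\<^esub>) x)"
  using assms by (simp add: smult_assoc1 monoid.one_closed [OF A_monoid] lact_mult [symmetric] unit_scalar(1,2))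

lemma end_abelian: "abelian_group E"
proof (rule abelian_groupI)
  interpret R: cring R by (rule R_cring)
  note cl = end_closed end_apply endE
  fix g assume g: "g \<in> carrier E"
  have m: "\<ominus>\<^bsub>R\<^esub> \<one>\<^bsub>R\<^esub> \<in> carrier R" by simp
  have "lact C (\<ominus>\<^bsub>R\<^esub> \<one>\<^bsub>R\<^esub> \<odot>\<^bsub>A\<^esub> \<one>\<^bsub>A\<^esub>) x \<oplus>\<^bsub>C\<^esub> x = \<zero>\<^bsub>C\<^esub>" if x: "x \<in> carrier C" for x
    using scalar_add [OF m R.one_closed x] x
    by (simp add: R.l_neg monoid.one_closed [OF A_monoid] lact_zero smult_one lact_one)
  then have "(\<ominus>\<^bsub>R\<^esub> \<one>\<^bsub>R\<^esub> \<odot>\<^bsub>E\<^esub> g) \<oplus>\<^bsub>E\<^esub> g = \<zero>\<^bsub>E\<^esub>"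
    by (intro end_eqI) (simp_all add: cl g m)
  then show "\<exists>h \<in> carrier E. h \<oplus>\<^bsub>E\<^esub> g = \<zero>\<^bsub>E\<^esub>"
    using end_closed(5) [OF m g] by blast
  show "\<zero>\<^bsub>E\<^esub> \<oplus>\<^bsub>E\<^esub> g = g"
    by (intro end_eqI) (simp_all add: cl g abelian_groupE(5) [OF C_abelian])
  fix h assume h: "h \<in> carrier E"
  show "g \<oplus>\<^bsub>E\<^esub> h = h \<oplus>\<^bsub>E\<^esub> g"
    by (intro end_eqI) (simp_all add: cl g h C_ac)
  fix k assume k: "k \<in> carrier E"
  show "g \<oplus>\<^bsub>E\<^esub> h \<oplus>\<^bsub>E\<^esub> k = g \<oplus>\<^bsub>E\<^esub> (h \<oplus>\<^bsub>E\<^esub> k)"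
    by (intro end_eqI) (simp_all add: cl g h k C_ac)
qed (simp_all add: end_closed)

lemma end_ring: "ring E"
proof (rule ringI [OF end_abelian])
  note cl = end_closed end_apply endE endosD(5) [OF endE(1)]
  show "monoid E"
    by (rule monoidI) (auto intro!: end_eqI simp: cl)
  fix g h k assume "g \<in> carrier E" "h \<in> carrier E" "k \<in> carrier E"
  then show "(g \<oplus>\<^bsub>E\<^esub> h) \<otimes>\<^bsub>E\<^esub> k = g \<otimes>\<^bsub>E\<^esub> k \<oplus>\<^bsub>E\<^esub> h \<otimes>\<^bsub>E\<^esub> k"
    "k \<otimes>\<^bsub>E\<^esub> (g \<oplus>\<^bsub>E\<^esub> h) = k \<otimes>\<^bsub>E\<^esub> g \<oplus>\<^bsub>E\<^esub> k \<otimes>\<^bsub>E\<^esub> h"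
    by (auto intro!: end_eqI simp: cl)
qed

lemma end_cring: "cring E"
  using end_ring ringE(2) [OF end_ring]
  by (auto intro!: cring.intro comm_monoid.intro comm_monoid_axioms.intro end_eqI
      simp: end_closed end_apply endE endos_commute)

lemma end_algebra: "assoc_algebra R E"
proof (intro assoc_algebra.intro assoc_algebra_axioms.intro)
  note cl = end_closed end_apply endE endosD(5) [OF endE(1)]
  show "ring E" by (rule end_ring)
  show "module R E"
    by (rule moduleI [OF R_cring end_abelian])
       (auto intro!: end_eqI simp: cl scalar_add smult_one lact_one monoid.one_closed [OF A_monoid] scalar_mult lact_add unit_scalar
         ring.ring_simprules [OF cring.axioms(1) [OF R_cring]])
  fix r g h assume "r \<in> carrier R" "g \<in> carrier E" "h \<in> carrier E"
  then show "(r \<odot>\<^bsub>E\<^esub> g) \<otimes>\<^bsub>E\<^esub> h = r \<odot>\<^bsub>E\<^esub> (g \<otimes>\<^bsub>E\<^esub> h)"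
    "g \<otimes>\<^bsub>E\<^esub> (r \<odot>\<^bsub>E\<^esub> h) = r \<odot>\<^bsub>E\<^esub> (g \<otimes>\<^bsub>E\<^esub> h)"
    by (auto intro!: end_eqI simp: cl endosD(6) [OF endE(1)] unit_scalar)
qed

end

section \<open>The centralizer\<close>

text \<open>The centralizer receives its algebra laws along \<open>g \<mapsto> \<epsilon> \<circ> g\<close> from the endomorphism algebra, where
  multiplication is composition and the laws are evident.\<close>

lemma assoc_algebra_transport:
  fixes R :: "('r, 'p) ring_scheme" and X :: "('r, 'x, 'q) module_scheme" and Y :: "('r, 'y, 's) module_scheme"
  assumes X: "assoc_algebra R X" and h: "h \<in> ring_iso X Y" and zero: "h \<zero>\<^bsub>X\<^esub> = \<zero>\<^bsub>Y\<^esub>"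
    and smult: "\<And>r x. \<lbrakk>r \<in> carrier R; x \<in> carrier X\<rbrakk> \<Longrightarrow> h (r \<odot>\<^bsub>X\<^esub> x) = r \<odot>\<^bsub>Y\<^esub> h x"
  shows "assoc_algebra R Y"
proof -
  have modX: "module R X" and ringX: "ring X" using X by (simp_all add: assoc_algebra_def)
  interpret gX: abelian_group X by (rule module.axioms(2) [OF modX])
  interpret rX: ring X by (rule ringX)
  have cr: "cring R" by (rule module.axioms(1) [OF modX])
  interpret R: cring R by (rule cr)
  note hm = ring_iso_memE [OF h]
  note [simp] = hm(1) hm(2,3) [symmetric] hm(4) [symmetric] zero [symmetric] smult [symmetric]
  note [simp del] = hm(4) zero
  have img: "\<exists>x \<in> carrier X. y = h x" if "y \<in> carrier Y" for y
    using hm(5) that by (auto simp: bij_betw_def)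
  have abY: "abelian_group Y"
  proof (rule abelian_groupI)
    fix a b c assume abc: "a \<in> carrier Y" "b \<in> carrier Y" "c \<in> carrier Y"
    then show "a \<oplus>\<^bsub>Y\<^esub> b \<oplus>\<^bsub>Y\<^esub> c = a \<oplus>\<^bsub>Y\<^esub> (b \<oplus>\<^bsub>Y\<^esub> c)"
      using abc by (auto dest!: img simp: gX.a_assoc)
  next
    fix a b assume "a \<in> carrier Y" "b \<in> carrier Y"
    then show "a \<oplus>\<^bsub>Y\<^esub> b = b \<oplus>\<^bsub>Y\<^esub> a" "a \<oplus>\<^bsub>Y\<^esub> b \<in> carrier Y"
      by (auto dest!: img simp: gX.a_comm)
  next
    fix a assume "a \<in> carrier Y"
    then obtain x where x: "x \<in> carrier X" "a = h x" using img by blast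
    then show "\<exists>b \<in> carrier Y. b \<oplus>\<^bsub>Y\<^esub> a = \<zero>\<^bsub>Y\<^esub>"
      by (intro bexI [of _ "h (\<ominus>\<^bsub>X\<^esub> x)"]) (simp_all add: gX.l_neg)
    show "\<zero>\<^bsub>Y\<^esub> \<oplus>\<^bsub>Y\<^esub> a = a" using x by simp
  qed simp
  have "module R Y"
    by (rule moduleI [OF cr abY])
       (auto dest!: img simp: module.smult_closed [OF modX] module.smult_l_distr [OF modX]
         module.smult_r_distr [OF modX] module.smult_assoc1 [OF modX] module.smult_one [OF modX])
  moreover have "monoid Y"
    by (rule monoidI) (auto dest!: img simp: rX.m_assoc)
  then have "ring Y"
    by (intro ringI [OF abY]) (auto dest!: img simp: rX.l_distr rX.r_distr)
  moreover have "assoc_algebra_axioms R Y"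
    by (rule assoc_algebra_axioms.intro)
       (auto dest!: img simp: module.smult_closed [OF modX] assoc_algebra.smult_mult_left [OF X] assoc_algebra.smult_mult_right [OF X])
  ultimately show ?thesis by (simp add: assoc_algebra_def)
qed

context A_coring
begin

abbreviation Z where "Z \<equiv> centralizer A C"

lemma centralizer_simps:
  "f \<in> carrier Z \<longleftrightarrow> f \<in> dual \<and> f \<in> extensional (carrier C) \<and>
     (\<forall>c \<in> carrier C. rharpoon C f c = lharpoon C c f)"
  "f \<otimes>\<^bsub>Z\<^esub> g = (\<lambda>c \<in> carrier C. tensor_sum A (\<lambda>x y. f x \<otimes>\<^bsub>A\<^esub> g y) (comult C c))"
  "\<one>\<^bsub>Z\<^esub> = restrict (counit C) (carrier C)"
  "\<zero>\<^bsub>Z\<^esub> = (\<lambda>c \<in> carrier C. \<zero>\<^bsub>A\<^esub>)"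
  "f \<oplus>\<^bsub>Z\<^esub> g = (\<lambda>c \<in> carrier C. f c \<oplus>\<^bsub>A\<^esub> g c)"
  "r \<odot>\<^bsub>Z\<^esub> f = (\<lambda>c \<in> carrier C. r \<odot>\<^bsub>A\<^esub> f c)"
  by (auto simp: centralizer_def bidual_def)

lemma psi_apply: "c \<in> carrier C \<Longrightarrow> psi C g c = counit C (g c)"
  by (simp add: psi_def compose_def)

lemma psi_ext: "psi C g \<in> extensional (carrier C)"
  by (simp add: psi_def)

lemma phi_mem:
  assumes "f \<in> carrier Z"
  shows "phi C f \<in> carrier E"
  unfolding phi_def
  by (rule restrict_endos, rule harpoon_endos) (use assms in \<open>auto simp: centralizer_simps\<close>)

lemma psi_mem: "g \<in> carrier E \<Longrightarrow> psi C g \<in> carrier Z"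
  using counit_endo [OF endE(1), of g "psi C g"] by (simp add: centralizer_simps(1) psi_ext psi_apply)

lemma psi_phi:
  assumes "f \<in> carrier Z"
  shows "psi C (phi C f) = f"
proof (rule extensionalityI [OF psi_ext])
  show "psi C (phi C f) c = f c" if "c \<in> carrier C" for c
    using that assms counit_rharpoon [of f c] by (simp only: centralizer_simps psi_apply phi_def restrict_apply')
qed (use assms in \<open>simp add: centralizer_simps\<close>)

lemma phi_psi:
  assumes "g \<in> carrier E"
  shows "phi C (psi C g) = g"
  by (rule end_eqI [OF phi_mem [OF psi_mem [OF assms]] assms])
     (simp add: phi_def counit_endo(2) [OF endE(1) [OF assms], of "psi C g"] psi_apply)

lemma psi_iso: "psi C \<in> ring_iso E Z"
proof (rule ring_iso_memI)
  show "bij_betw (psi C) (carrier E) (carrier Z)"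
    by (rule bij_betw_byWitness [of _ "phi C"]) (use psi_phi phi_psi psi_mem phi_mem in auto)
  fix g h assume g: "g \<in> carrier E" and h: "h \<in> carrier E"
  show "psi C g \<in> carrier Z" by (rule psi_mem [OF g])
  show "psi C (g \<otimes>\<^bsub>E\<^esub> h) = psi C g \<otimes>\<^bsub>Z\<^esub> psi C h"
    by (rule extensionalityI [OF psi_ext])
       (auto simp: centralizer_simps psi_apply end_apply
         convolution_counit [OF endE(1) [OF g] endE(1) [OF h], of "psi C g" "psi C h"])
  show "psi C (g \<oplus>\<^bsub>E\<^esub> h) = psi C g \<oplus>\<^bsub>Z\<^esub> psi C h"
    by (rule extensionalityI [OF psi_ext])
       (auto simp: centralizer_simps psi_apply end_apply dualD [OF counit_hom] endE g h)
next
  show "psi C \<one>\<^bsub>E\<^esub> = \<one>\<^bsub>Z\<^esub>"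
    by (rule extensionalityI [OF psi_ext])
       (auto simp: centralizer_simps psi_apply end_apply)
qed

lemma psi_zero: "psi C \<zero>\<^bsub>E\<^esub> = \<zero>\<^bsub>Z\<^esub>"
  by (rule extensionalityI [OF psi_ext])
     (auto simp: centralizer_simps psi_apply end_apply
       additive_zero [OF C_abelian A_abelian counit_additive])

lemma psi_smult:
  assumes "r \<in> carrier R" "g \<in> carrier E"
  shows "psi C (r \<odot>\<^bsub>E\<^esub> g) = r \<odot>\<^bsub>Z\<^esub> psi C g"
  by (rule extensionalityI [OF psi_ext])
     (use assms in \<open>auto simp: centralizer_simps psi_apply end_apply dualD [OF counit_hom] endE unit_scalar\<close>)

lemma centralizer_algebra: "assoc_algebra R Z"
  by (rule assoc_algebra_transport [where h = "psi C", OF end_algebra psi_iso psi_zero psi_smult])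

lemma phi_algebra_iso: "phi C \<in> algebra_iso R Z E"
proof -
  note P = ring_iso_memE [OF psi_iso]
  have phi_eqI: "phi C f = g" if "f = psi C g" "g \<in> carrier E" for f g
    using that phi_psi by simp
  have "phi C \<in> ring_iso Z E"
  proof (rule ring_iso_memI)
    show "bij_betw (phi C) (carrier Z) (carrier E)"
      by (rule bij_betw_byWitness [of _ "psi C"]) (use psi_phi phi_psi psi_mem phi_mem in auto)
    fix f g assume f: "f \<in> carrier Z" and g: "g \<in> carrier Z"
    show "phi C f \<in> carrier E" by (rule phi_mem [OF f])
    show "phi C (f \<otimes>\<^bsub>Z\<^esub> g) = phi C f \<otimes>\<^bsub>E\<^esub> phi C g"
      by (rule phi_eqI) (simp_all add: P(2) phi_mem f g psi_phi end_closed)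
    show "phi C (f \<oplus>\<^bsub>Z\<^esub> g) = phi C f \<oplus>\<^bsub>E\<^esub> phi C g"
      by (rule phi_eqI) (simp_all add: P(3) phi_mem f g psi_phi end_closed)
  next
    show "phi C \<one>\<^bsub>Z\<^esub> = \<one>\<^bsub>E\<^esub>"
      by (rule phi_eqI) (simp_all add: P(4) end_closed)
  qed
  moreover have "phi C (r \<odot>\<^bsub>Z\<^esub> f) = r \<odot>\<^bsub>E\<^esub> phi C f" if "r \<in> carrier R" "f \<in> carrier Z" for r f
    by (rule phi_eqI) (simp_all add: psi_smult phi_mem that psi_phi end_closed)
  ultimately show ?thesis by (simp add: algebra_iso_def)
qed

section \<open>A coring as a bicomodule over itself\<close>

lemma self_bimodule: "bimodule R A S"
proof -
  have "abelian_group S"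
    by (rule abelian_groupI) (use abelian_groupE [OF C_abelian] in simp_all)
  then show ?thesis
    using left_module_axioms right_module_axioms assoc_algebra_axioms
    by (auto simp: bimodule_def bimodule_axioms_def left_module_def right_module_def
        left_module_axioms_def right_module_axioms_def lact_ract central)
qed

lemma self_bicomodule: "bicomodule R A C S"
proof (intro bicomodule.intro bicomodule_axioms.intro)
  show "A_coring R A C" by (rule A_coring_axioms)
  show "bimodule R A S" by (rule self_bimodule)
qed (use comult_hom coassoc counit_left counit_right in \<open>simp_all add: tensor_sum_self\<close>)

text \<open>For \<open>l \<in> L\<close>, with \<open>h = \<epsilon> \<circ> g\<close>, the value \<open>g l = \<Sum> l\<^sub>1 h(l\<^sub>2)\<close> can be computed from the coaction
  \<open>\<rho> l \<in> L \<otimes> C\<close> of the subbicomodule instead of \<open>\<Delta> l\<close>; it is then a sum of elements \<open>x a\<close> with \<open>x \<in> L\<close>.\<close>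

lemma self_duo: "duo R A C S"
  unfolding duo_def
proof (intro allI impI ballI subsetI)
  fix L g y assume "subbicomodule R A C S L" and g: "g \<in> endos" and "y \<in> g ` L"
  then obtain \<rho> \<sigma> l where LC: "L \<subseteq> carrier C" and l: "l \<in> L" "y = g l"
    and K: "bicomodule R A C (S\<lparr>carrier := L, rcoact := \<rho>, lcoact := \<sigma>\<rparr>)"
    and inc: "(\<lambda>x. x) \<in> bicolinear A C (S\<lparr>carrier := L, rcoact := \<rho>, lcoact := \<sigma>\<rparr>) S"
    by (auto simp: subbicomodule_def Let_def)
  define K where "K = S\<lparr>carrier := L, rcoact := \<rho>, lcoact := \<sigma>\<rparr>"
  have K_simps [simp]: "carrier K = L" "add K = add C" "lact K = lact C" "ract K = ract C" "rcoact K = \<rho>"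
    by (simp_all add: K_def)
  interpret K: bicomodule R A C K using K by (simp add: K_def)
  have Kr: "right_module A K" by (rule K.M.right_module_axioms)
  interpret KC: tensor_factors A K C
    by (simp add: tensor_factors_def Kr left_module_axioms)
  let ?h = "\<lambda>c. counit C (g c)"
  note h = counit_endo [OF g, of ?h]
  have hd: "?h \<in> dual" by (rule h) simp
  have inc_hom: "(\<lambda>x. x) \<in> bimod_hom A K C" using LC by (auto intro!: bimod_homI simp: additive_def)
  have I: "tensor_map A C C (\<lambda>x. x) id \<in> additive (tensor_group A K C) TC"
    "\<And>x y. \<lbrakk>x \<in> L; y \<in> carrier C\<rbrakk> \<Longrightarrow> tensor_map A C C (\<lambda>x. x) id (tens A K C x y) = tens A C C x y"
    using tensor_map_additive [OF KC.tensor_factors_axioms coring_tensor_factors(1) bimod_homD(2) [OF inc_hom]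
        bimod_homD(1) [OF bimod_hom_id(2)]]
      tensor_map_tens [OF KC.tensor_factors_axioms coring_tensor_factors(1) bimod_homD(2) [OF inc_hom]
        bimod_homD(1) [OF bimod_hom_id(2)]] by simp_all
  have closed: "contract_right ?h (tensor_map A C C (\<lambda>x. x) id u) \<in> L"
    if "u \<in> carrier (tensor_group A K C)" for u
    using that
  proof (induction u rule: KC.tensor_induct)
    case (tens x y)
    then have x: "x \<in> L" "x \<in> carrier C" using LC by auto
    have "contract_right ?h (tensor_map A C C (\<lambda>x. x) id (tens A K C x y)) = ract C x (?h y)"
      unfolding I(2) [OF x(1) tens(2)] by (rule contract_right_tens [OF hd x(2) tens(2)])
    also have "\<dots> \<in> L"
      using right_module.ract_closed [OF Kr dualD(1) [OF hd tens(2)], of x] x(1) by simp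
    finally show ?case .
  next
    case (add u v)
    show ?case
      unfolding additive_add [OF I(1) add(1,2)] additive_add [OF contract_right_additive [OF hd]
          additive_closed [OF I(1) add(1)] additive_closed [OF I(1) add(2)]]
      by (rule abelian_groupE(1) [OF right_module.axioms(2) [OF Kr], unfolded K_simps, OF add(3,4)])
  qed
  have \<rho>: "\<rho> l \<in> carrier (tensor_group A K C)"
    using bimod_homD(4) [OF K.rcoact_hom, of l] l by simp
  have "comult C l = tensor_map A C C (\<lambda>x. x) id (\<rho> l)"
    using inc l by (simp add: bicolinear_def)
  then have "g l = contract_right ?h (tensor_map A C C (\<lambda>x. x) id (\<rho> l))"
    using h(2) [of l] l LC by (auto simp: rharpoon_eq subset_iff)
  then show "y \<in> L" using closed [OF \<rho>] l by simp
qed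

end

theorem lemma4p5:
  fixes R :: "('r, 'p) ring_scheme"
    and A :: "('r, 'a, 'q) module_scheme"
    and C :: "('a, 'c, 'v) coring_scheme"
  assumes "cring R" and "\<one>\<^bsub>R\<^esub> \<noteq> \<zero>\<^bsub>R\<^esub>"
    and "assoc_algebra R A"
    and "A_coring R A C"
    and "carrier C \<noteq> {\<zero>\<^bsub>C\<^esub>}"
    and "flat_left A C" and "flat_right A C"
  shows "assoc_algebra R (centralizer A C)
    \<and> assoc_algebra R (bicomod_end A C (self_bicomod C))
    \<and> phi C \<in> algebra_iso R (centralizer A C) (bicomod_end A C (self_bicomod C))
    \<and> (\<forall>f \<in> carrier (centralizer A C). phi C f = (\<lambda>c \<in> carrier C. lharpoon C c f))
    \<and> psi C \<in> carrier (bicomod_end A C (self_bicomod C)) \<rightarrow> carrier (centralizer A C)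
    \<and> (\<forall>f \<in> carrier (centralizer A C). psi C (phi C f) = f)
    \<and> (\<forall>g \<in> carrier (bicomod_end A C (self_bicomod C)). phi C (psi C g) = g)
    \<and> cring (bicomod_end A C (self_bicomod C))
    \<and> bicomodule R A C (self_bicomod C)
    \<and> duo R A C (self_bicomod C)"
proof -
  interpret A_coring R A C by fact
  have "phi C f = (\<lambda>c \<in> carrier C. lharpoon C c f)" if "f \<in> carrier Z" for f
    using that by (auto simp: phi_def centralizer_simps intro!: restrict_ext)
  then show ?thesis
    using centralizer_algebra end_algebra phi_algebra_iso psi_mem psi_phi phi_psi end_cring
      self_bicomodule self_duo by blast
qed

end
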